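(* For $T\in\mathcal{J}(\mathcal{H})$ and $k=1,2,\dots,\infty$, $$|||T|||_{(k)}^\#=\max\left\{\|T\|,\ \frac1k\|T\|_1\right\},$$ where $|||T|||_{(k)}=s_1(T)+\cdots+s_k(T)$ (for $k=\infty$, the sum of all $s_i(T)$), $\|T\|_1=\mathrm{Tr}(|T|)=s_1(T)+s_2(T)+\cdots$ and $\frac1\infty=0$.
   Context: $\mathcal{H}$ is the separable infinite-dimensional complex Hilbert space, $\mathcal{J}(\mathcal{H})$ is the set of finite rank bounded operators on $\mathcal{H}$, $\|\cdot\|$ is the operator norm, and $s_1(T)\ge s_2(T)\ge\cdots\ge0$ are the singular values of $T$ counted with multiplicity. For a norm $|||\cdot|||$ on $\mathcal{J}(\mathcal{H})$, the dual norm is $|||T|||^\#=\sup\{|\mathrm{Tr}(TX)|:\ X\in\mathcal{J}(\mathcal{H}),\ |||X|||\le1\}$; $|||\cdot|||_{(k)}^\#$ is the dual norm of $|||\cdot|||_{(k)}$. *)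

theory Defs
  imports "HOL-Analysis.Analysis" "HOL-Library.Extended_Nat"
begin

section \<open>Complex Hilbert spaces\<close>

text \<open>
  The topology, the norm and the underlying real inner product come from \<^class>\<open>real_inner\<close>;
  the real inner product is the real part of the complex one, so that
  \<open>norm x = sqrt (Re (cinner x x))\<close>.  The complex inner product is linear in its first argument.
\<close>

class complex_inner = real_inner +
  fixes scaleC :: "complex \<Rightarrow> 'a \<Rightarrow> 'a"  (infixr "*\<^sub>C" 75)
    and cinner :: "'a \<Rightarrow> 'a \<Rightarrow> complex"
  assumes scaleC_add_right: "c *\<^sub>C (x + y) = c *\<^sub>C x + c *\<^sub>C y"
    and scaleC_add_left: "(c + d) *\<^sub>C x = c *\<^sub>C x + d *\<^sub>C x"
    and scaleC_scaleC: "c *\<^sub>C (d *\<^sub>C x) = (c * d) *\<^sub>C x"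
    and scaleC_of_real: "complex_of_real r *\<^sub>C x = r *\<^sub>R x"
    and cinner_add_left: "cinner (x + y) z = cinner x z + cinner y z"
    and cinner_scaleC_left: "cinner (c *\<^sub>C x) y = c * cinner x y"
    and cinner_commute: "cinner x y = cnj (cinner y x)"
    and inner_eq_Re_cinner: "inner x y = Re (cinner x y)"

class complex_hilbert = complex_inner + complete_space
begin

subclass banach ..

end

global_interpretation complex_vector:
    vector_space "scaleC :: complex \<Rightarrow> 'a \<Rightarrow> 'a::complex_inner"
proof
  fix x :: 'a
  show "1 *\<^sub>C x = x"
    using scaleC_of_real[of 1 x] by simp
qed (simp_all add: scaleC_add_right scaleC_add_left scaleC_scaleC)

definition orthonormal_basis :: "'a::complex_inner set \<Rightarrow> bool" where
  "orthonormal_basis B \<longleftrightarrow>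
     (\<forall>e\<in>B. norm e = 1) \<and> (\<forall>e\<in>B. \<forall>f\<in>B. e \<noteq> f \<longrightarrow> cinner e f = 0) \<and>
     closure (complex_vector.span B) = UNIV"

section \<open>Operators\<close>

definition bounded_op :: "('a::complex_inner \<Rightarrow> 'a) \<Rightarrow> bool" where
  "bounded_op T \<longleftrightarrow> bounded_linear T \<and> (\<forall>c x. T (c *\<^sub>C x) = c *\<^sub>C T x)"

definition finite_rank_ops :: "('a::complex_inner \<Rightarrow> 'a) set" where
  "finite_rank_ops =
     {T. bounded_op T \<and> (\<exists>B. finite B \<and> range T \<subseteq> complex_vector.span B)}"

definition adjoint_op :: "('a::complex_inner \<Rightarrow> 'a) \<Rightarrow> ('a \<Rightarrow> 'a)" where
  "adjoint_op T = (THE S. \<forall>x y. cinner (T x) y = cinner x (S y))"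

definition positive_op :: "('a::complex_inner \<Rightarrow> 'a) \<Rightarrow> bool" where
  "positive_op P \<longleftrightarrow> bounded_op P \<and> (\<forall>x. cinner (P x) x \<in> \<real>\<^sub>\<ge>\<^sub>0)"

definition abs_op :: "('a::complex_inner \<Rightarrow> 'a) \<Rightarrow> ('a \<Rightarrow> 'a)" where
  "abs_op T = (THE P. positive_op P \<and> P \<circ> P = adjoint_op T \<circ> T)"

text \<open>For finite rank operators the trace does not depend on the orthonormal basis that is chosen.\<close>

definition trace_op :: "('a::complex_inner \<Rightarrow> 'a) \<Rightarrow> complex" where
  "trace_op T = (\<Sum>\<^sub>\<infinity>e\<in>(SOME B. orthonormal_basis B). cinner (T e) e)"

definition trace_norm :: "('a::complex_inner \<Rightarrow> 'a) \<Rightarrow> real" where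
  "trace_norm T = Re (trace_op (abs_op T))"

section \<open>Singular values\<close>

definition eigenspace :: "('a::complex_inner \<Rightarrow> 'a) \<Rightarrow> real \<Rightarrow> 'a set" where
  "eigenspace P \<sigma> = {x. P x = complex_of_real \<sigma> *\<^sub>C x}"

text \<open>
  The list of the positive eigenvalues of \<open>|T|\<close> in decreasing order, each one repeated according
  to its multiplicity.  It is meant for operators of finite rank, for which there are only finitely
  many positive eigenvalues and all their eigenspaces are finite-dimensional.
\<close>

definition positive_singular_values :: "('a::complex_inner \<Rightarrow> 'a) \<Rightarrow> real list" where
  "positive_singular_values T =
     concat (map (\<lambda>\<sigma>. replicate (complex_vector.dim (eigenspace (abs_op T) \<sigma>)) \<sigma>)
       (rev (sorted_list_of_set {\<sigma>. \<sigma> > 0 \<and> eigenspace (abs_op T) \<sigma> \<noteq> {0}})))"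

text \<open>
  \<open>singular_value T i\<close> is \<open>s\<^sub>i(T)\<close> for \<open>i \<ge> 1\<close>; the sequence continues with zeros after the
  positive singular values.  The index \<open>0\<close> is not used.
\<close>

definition singular_value :: "('a::complex_inner \<Rightarrow> 'a) \<Rightarrow> nat \<Rightarrow> real" where
  "singular_value T i =
     (if 1 \<le> i \<and> i \<le> length (positive_singular_values T)
      then positive_singular_values T ! (i - 1) else 0)"

section \<open>Norms on the finite rank operators\<close>

definition ky_fan_norm :: "enat \<Rightarrow> ('a::complex_inner \<Rightarrow> 'a) \<Rightarrow> real" where
  "ky_fan_norm k T =
     (case k of
        enat n \<Rightarrow> (\<Sum>i=1..n. singular_value T i)
      | \<infinity> \<Rightarrow> (\<Sum>i. singular_value T (Suc i)))"

text \<open>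
  The supremum is taken in the extended reals, where it always exists; an equation with a real
  number hence includes that the set is bounded.
\<close>

definition dual_norm ::
  "(('a::complex_inner \<Rightarrow> 'a) \<Rightarrow> real) \<Rightarrow> ('a \<Rightarrow> 'a) \<Rightarrow> ereal" where
  "dual_norm N T = (SUP X\<in>{X \<in> finite_rank_ops. N X \<le> 1}. ereal (cmod (trace_op (T \<circ> X))))"

text \<open>In \<^typ>\<open>ereal\<close>, \<open>1 / \<infinity> = 0\<close>.\<close>

lemma one_over_infinity: "1 / ereal_of_enat \<infinity> = 0"
  by simp

end

(* T has a singular value decomposition T x = sum_{i<n} s_i <x, f_i> e_i. It is found by deflation:
   since the range of T is finite-dimensional, a maximising sequence for the norm of T converges to
   a unit vector f with |T f| = |T|; the orthogonal complement of f is mapped to the complement of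
   T f, so that subtracting the corresponding rank one term lowers the rank.

   If X has the singular values t_j and the singular vectors g_j, h_j, then
   Tr(T X) = sum_j t_j <T g_j, h_j>. The numbers u_j = |<T g_j, h_j>| are at most |T|, and their sum
   is at most the trace norm of T, by Bessel's inequality. As the t_j decrease, this gives
   |Tr(T X)| <= max (|T|, |T|_1 / k) (t_1 + ... + t_k). Equality is attained at x |-> <x, e_0> f_0
   and at x |-> (1/k) sum_i <x, e_i> f_i. *)

theory Submission
  imports Defs
begin

text \<open>The definitions hide their objects behind \<open>THE\<close>, \<open>SOME\<close> and
  infinite sums, and the decomposition resolves each of them. It exhibits the adjoint and a positive
  square root, but both must also be shown unique before the eigenspaces of |T| can be read off.
  Separability provides an orthonormal basis, so that the set chosen by \<open>SOME\<close> in
  \<open>trace_op\<close> really is one; Parseval then evaluates the trace of any finite sum of rank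
  one operators.

  A unit ball in infinite dimension is not compact, so a maximising sequence of unit vectors does
  not converge for free. Compactness is available only for the images, which lie in the
  finite-dimensional range, and has to be carried back to the vectors.

  The constant max (|T|, |T|_1 / k) is the least M with |T| <= M and |T|_1 <= k M: one condition
  caps each u_j, the other caps their total. For k = infinity the second condition disappears, in
  agreement with 1 / infinity = 0.\<close>

section \<open>The complex inner product and its link to the real one\<close>

lemma cinner_add_right: "cinner x (y + z) = cinner x y + cinner x (z::'a::complex_inner)"
  by (metis cinner_add_left cinner_commute complex_cnj_add)

lemma cinner_scaleC_right: "cinner x (c *\<^sub>C y) = cnj c * cinner x (y::'a::complex_inner)"
  by (metis cinner_scaleC_left cinner_commute complex_cnj_mult)

lemma cinner_zero_left [simp]: "cinner 0 (x::'a::complex_inner) = 0"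
  using cinner_add_left[of 0 0 x] by simp

lemma cinner_zero_right [simp]: "cinner (x::'a::complex_inner) 0 = 0"
  using cinner_add_right[of x 0 0] by simp

lemma cinner_diff_left: "cinner (x - y) z = cinner x z - cinner y (z::'a::complex_inner)"
  using cinner_add_left[of "x - y" y z] by simp

lemma cinner_diff_right: "cinner x (y - z) = cinner x y - cinner x (z::'a::complex_inner)"
  using cinner_add_right[of x "y - z" z] by simp

lemma cinner_sum_left: "cinner (\<Sum>i\<in>I. g i) (x::'a::complex_inner) = (\<Sum>i\<in>I. cinner (g i) x)"
  by (induction I rule: infinite_finite_induct) (auto simp: cinner_add_left)

lemma cinner_sum_right: "cinner (x::'a::complex_inner) (\<Sum>i\<in>I. g i) = (\<Sum>i\<in>I. cinner x (g i))"
  by (induction I rule: infinite_finite_induct) (auto simp: cinner_add_right)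

lemma cinner_self: "cinner x x = complex_of_real ((norm (x::'a::complex_inner))\<^sup>2)"
proof (rule complex_eqI)
  show "Re (cinner x x) = Re (complex_of_real ((norm x)\<^sup>2))"
    by (simp add: power2_norm_eq_inner inner_eq_Re_cinner)
  show "Im (cinner x x) = Im (complex_of_real ((norm x)\<^sup>2))"
    using arg_cong[OF cinner_commute[of x x], of Im] by simp
qed

lemma cinner_eq_zero_iff [simp]: "cinner x x = 0 \<longleftrightarrow> x = (0::'a::complex_inner)"
  by (simp add: cinner_self)

text \<open>The class ties the norm to real scalars only; complex homogeneity comes from
  sesquilinearity through \<open>cinner_self\<close>.\<close>

lemma norm_scaleC [simp]: "norm (c *\<^sub>C x) = cmod c * norm (x::'a::complex_inner)"
proof -
  have "complex_of_real ((norm (c *\<^sub>C x))\<^sup>2) = complex_of_real ((cmod c * norm x)\<^sup>2)"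
    unfolding cinner_self[symmetric] cinner_scaleC_left cinner_scaleC_right
    by (simp add: cinner_self power_mult_distrib complex_norm_square mult.commute del: of_real_power)
  then have "(norm (c *\<^sub>C x))\<^sup>2 = (cmod c * norm x)\<^sup>2"
    using of_real_eq_iff by blast
  then show ?thesis
    by (simp add: power2_eq_iff_nonneg)
qed

lemma cmod_cinner_le: "cmod (cinner x y) \<le> norm x * norm (y::'a::complex_inner)"
proof (cases "cinner x y = 0")
  case False
  \<comment> \<open>A phase that turns the inner product into its modulus, so that the real
    Cauchy-Schwarz inequality applies.\<close>
  define c where "c = cnj (cinner x y) / cmod (cinner x y)"
  have "cmod c = 1"
    using False by (simp add: c_def norm_divide)
  have "complex_of_real (cmod (cinner x y)) = cinner (c *\<^sub>C x) y"
    using False complex_norm_square[of "cinner x y"]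
    by (simp add: c_def cinner_scaleC_left field_simps power2_eq_square)
  then have "cmod (cinner x y) = Re (cinner (c *\<^sub>C x) y)"
    by (metis Re_complex_of_real)
  also have "\<dots> \<le> norm (c *\<^sub>C x) * norm y"
    by (metis inner_eq_Re_cinner norm_cauchy_schwarz)
  finally show ?thesis
    using \<open>cmod c = 1\<close> by simp
qed auto

lemma bounded_linear_cinner_left: "bounded_linear (\<lambda>x. cinner x (y::'a::complex_inner))"
proof (rule bounded_linear_intro[where K = "norm y"])
  show "cinner (r *\<^sub>R x) y = r *\<^sub>R cinner x y" for r x
    by (metis cinner_scaleC_left scaleC_of_real scaleR_conv_of_real)
qed (auto simp: cinner_add_left cmod_cinner_le)

lemma bounded_linear_scaleC_left: "bounded_linear (\<lambda>c. c *\<^sub>C (x::'a::complex_inner))"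
proof (rule bounded_linear_intro[where K = "norm x"])
  show "(r *\<^sub>R c) *\<^sub>C x = r *\<^sub>R (c *\<^sub>C x)" for r and c :: complex
    by (metis scaleC_of_real scaleC_scaleC scaleR_conv_of_real)
qed (auto simp: scaleC_add_left)

lemma cinner_ext: "(\<And>z. cinner z x = cinner z y) \<Longrightarrow> x = (y::'a::complex_inner)"
  by (metis cinner_diff_right cinner_eq_zero_iff eq_iff_diff_eq_0)

lemma norm_add_orthogonal:
  "cinner x y = 0 \<Longrightarrow> (norm (x + y))\<^sup>2 = (norm x)\<^sup>2 + (norm (y::'a::complex_inner))\<^sup>2"
  using power2_norm_eq_inner[of "x + y"] power2_norm_eq_inner[of x] power2_norm_eq_inner[of y]
  by (simp add: inner_add inner_commute[of y x] inner_eq_Re_cinner[of x y])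

section \<open>Orthonormal families\<close>

text \<open>Indexed families allow the two systems of a decomposition to be paired by index; a set
  is treated as the family \<open>id\<close>.\<close>

definition orthonormal_on :: "'i set \<Rightarrow> ('i \<Rightarrow> 'a::complex_inner) \<Rightarrow> bool" where
  "orthonormal_on I e \<longleftrightarrow> (\<forall>i\<in>I. \<forall>j\<in>I. cinner (e i) (e j) = (if i = j then 1 else 0))"

lemma orthonormal_onD:
  "orthonormal_on I e \<Longrightarrow> i \<in> I \<Longrightarrow> j \<in> I \<Longrightarrow> cinner (e i) (e j) = (if i = j then 1 else 0)"
  by (simp add: orthonormal_on_def)

lemma orthonormal_on_norm: "orthonormal_on I e \<Longrightarrow> i \<in> I \<Longrightarrow> norm (e i) = 1"
  using orthonormal_onD[of I e i i] norm_ge_zero[of "e i"]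
  by (simp add: cinner_self power2_eq_1_iff del: of_real_power)

lemma orthonormal_on_inj: "orthonormal_on I e \<Longrightarrow> inj_on e I"
  by (intro inj_onI) (metis orthonormal_onD zero_neq_one)

lemma orthonormal_on_subset: "orthonormal_on I e \<Longrightarrow> J \<subseteq> I \<Longrightarrow> orthonormal_on J e"
  unfolding orthonormal_on_def by blast

lemma orthonormal_coefficient:
  assumes "orthonormal_on I e" "finite I" "j \<in> I"
  shows "cinner (\<Sum>i\<in>I. c i *\<^sub>C e i) (e j) = c j"
proof -
  have "cinner (\<Sum>i\<in>I. c i *\<^sub>C e i) (e j) = (\<Sum>i\<in>I. if i = j then c i else 0)"
    unfolding cinner_sum_left cinner_scaleC_left
    using assms by (intro sum.cong) (auto simp: orthonormal_onD)
  then show ?thesis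
    using assms by simp
qed

lemma norm_orthonormal_sum:
  assumes "orthonormal_on I e" "finite I"
  shows "(norm (\<Sum>i\<in>I. c i *\<^sub>C e i))\<^sup>2 = (\<Sum>i\<in>I. (cmod (c i))\<^sup>2)"
proof -
  have "complex_of_real ((norm (\<Sum>i\<in>I. c i *\<^sub>C e i))\<^sup>2) = (\<Sum>j\<in>I. cnj (c j) * c j)"
    unfolding cinner_self[symmetric]
    using assms by (subst cinner_sum_right) (simp add: cinner_scaleC_right orthonormal_coefficient)
  also have "\<dots> = complex_of_real (\<Sum>i\<in>I. (cmod (c i))\<^sup>2)"
    by (simp add: complex_norm_square mult.commute del: of_real_power)
  finally show ?thesis
    using of_real_eq_iff by blast
qed

definition proj :: "'i set \<Rightarrow> ('i \<Rightarrow> 'a::complex_inner) \<Rightarrow> 'a \<Rightarrow> 'a" where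
  "proj I e x = (\<Sum>i\<in>I. cinner x (e i) *\<^sub>C e i)"

lemma proj_in_span: "proj I e x \<in> complex_vector.span (e ` I)"
  unfolding proj_def
  by (intro complex_vector.span_sum complex_vector.span_scale complex_vector.span_base) auto

lemma cinner_diff_proj:
  "orthonormal_on I e \<Longrightarrow> finite I \<Longrightarrow> j \<in> I \<Longrightarrow> cinner (x - proj I e x) (e j) = 0"
  unfolding cinner_diff_left proj_def by (subst orthonormal_coefficient) auto

lemma cinner_span_eq_zero:
  assumes "\<And>b. b \<in> B \<Longrightarrow> cinner x b = 0" "y \<in> complex_vector.span B"
  shows "cinner x (y::'a::complex_inner) = 0"
  using assms(2)
  by (induction rule: complex_vector.span_induct_alt)
    (auto simp: cinner_add_right cinner_scaleC_right assms(1))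

text \<open>Pythagoras for x - y = (x - Px) + (Px - y): the second summand lies in the span, to
  which the first is orthogonal.\<close>

lemma proj_best_approximation:
  assumes "orthonormal_on I e" "finite I" "y \<in> complex_vector.span (e ` I)"
  shows "norm (x - proj I e x) \<le> norm (x - y)"
proof -
  have "cinner (x - proj I e x) (proj I e x - y) = 0"
    using assms cinner_diff_proj
    by - (rule cinner_span_eq_zero[of "e ` I"], auto intro: complex_vector.span_diff proj_in_span)
  from norm_add_orthogonal[OF this] have "(norm (x - proj I e x))\<^sup>2 \<le> (norm (x - y))\<^sup>2"
    by simp
  then show ?thesis
    by (rule power2_le_imp_le) simp
qed

text \<open>Here \<open>y\<close> competes with its own projection, so the distance between them is
  0.\<close>

lemma proj_eq:
  assumes "orthonormal_on I e" "finite I" "y \<in> complex_vector.span (e ` I)"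
  shows "proj I e y = y"
  using proj_best_approximation[OF assms, of y] by simp

lemma bessel:
  assumes "orthonormal_on I e" "finite I"
  shows "(\<Sum>i\<in>I. (cmod (cinner x (e i)))\<^sup>2) \<le> (norm x)\<^sup>2"
proof -
  have "cinner (x - proj I e x) (proj I e x) = 0"
    using assms cinner_diff_proj
    by - (rule cinner_span_eq_zero[of "e ` I"], auto intro!: proj_in_span)
  from norm_add_orthogonal[OF this]
  have "(norm x)\<^sup>2 = (norm (x - proj I e x))\<^sup>2 + (\<Sum>i\<in>I. (cmod (cinner x (e i)))\<^sup>2)"
    using norm_orthonormal_sum[OF assms] by (simp add: proj_def)
  then show ?thesis
    by simp
qed

text \<open>A member in the span of the others would be orthogonal to itself. This later gives the
  dimension of the eigenspaces.\<close>

lemma orthonormal_independent: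
  assumes "orthonormal_on I e"
  shows "complex_vector.independent (e ` I)"
proof
  assume "complex_vector.dependent (e ` I)"
  then obtain a where a: "a \<in> e ` I" "a \<in> complex_vector.span (e ` I - {a})"
    unfolding complex_vector.dependent_def by blast
  have "cinner a a = 0"
    using assms a by - (rule cinner_span_eq_zero[OF _ a(2)], auto simp: orthonormal_on_def)
  then show False
    using assms a orthonormal_on_norm[of I e] by fastforce
qed

section \<open>Gram-Schmidt and orthonormal bases\<close>

text \<open>Enlarging \<open>E\<close> instead of replacing it keeps the union over infinitely many
  steps orthonormal.\<close>

lemma gram_schmidt_step:
  assumes "orthonormal_on E id" "finite E"
  shows "\<exists>E'. orthonormal_on E' id \<and> finite E' \<and> E \<subseteq> E'
    \<and> x \<in> complex_vector.span (E'::'a::complex_inner set)"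
proof (cases "x \<in> complex_vector.span E")
  case True
  then show ?thesis
    using assms by (intro exI[of _ E]) auto
next
  case False
  define v where "v = x - proj E id x"
  define e where "e = complex_of_real (1 / norm v) *\<^sub>C v"
  have "v \<noteq> 0"
    using False proj_in_span[of E id x] unfolding v_def by auto
  have "cinner e e = 1"
    using \<open>v \<noteq> 0\<close> unfolding cinner_self e_def by (simp add: norm_divide)
  have orth: "cinner e b = 0" if "b \<in> E" for b
    using cinner_diff_proj[OF assms that, of x]
    unfolding e_def v_def cinner_scaleC_left by simp
  then have orth': "cinner b e = 0" if "b \<in> E" for b
    using that by (metis cinner_commute complex_cnj_zero)
  have "x = complex_of_real (norm v) *\<^sub>C e + proj E id x"
    using \<open>v \<noteq> 0\<close> by (simp add: e_def v_def scaleC_scaleC flip: of_real_mult)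
  also have "\<dots> \<in> complex_vector.span (insert e E)"
    using proj_in_span[of E id x] complex_vector.span_mono[of E "insert e E"]
    by (intro complex_vector.span_add complex_vector.span_scale)
      (auto intro: complex_vector.span_base)
  finally have "x \<in> complex_vector.span (insert e E)" .
  moreover have "orthonormal_on (insert e E) id"
    using assms(1) orth orth' \<open>cinner e e = 1\<close> unfolding orthonormal_on_def by auto
  ultimately show ?thesis
    using assms(2) by (intro exI[of _ "insert e E"]) auto
qed

lemma gram_schmidt:
  assumes "finite B"
  shows "\<exists>E. orthonormal_on E id \<and> finite E
    \<and> complex_vector.span B \<subseteq> complex_vector.span (E::'a::complex_inner set)"
  using assms
proof (induction B)
  case empty
  show ?case
    by (rule exI[of _ "{}"]) (simp add: orthonormal_on_def)
next
  case (insert b B)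
  then obtain E where E: "orthonormal_on E id" "finite E"
    "complex_vector.span B \<subseteq> complex_vector.span E"
    by blast
  from gram_schmidt_step[OF E(1,2)] obtain E' where E': "orthonormal_on E' id" "finite E'"
    "E \<subseteq> E'" "b \<in> complex_vector.span E'"
    by blast
  have "insert b B \<subseteq> complex_vector.span E'"
    using E(3) E'(3,4) complex_vector.span_mono[OF E'(3)] complex_vector.span_superset[of B]
    by blast
  then show ?case
    using E' complex_vector.span_minimal[OF _ complex_vector.subspace_span] by blast
qed

lemma orthonormal_basis_exists:
  assumes "separable_space (euclidean :: 'a::complex_inner topology)"
  shows "\<exists>B::'a set. orthonormal_basis B"
proof -
  obtain D :: "'a set" where D: "countable D" "closure D = UNIV"
    using assms unfolding separable_space_def euclidean_closure_of by auto
  have "D \<noteq> {}"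
    using D(2) by auto
  define d where "d = from_nat_into D"
  have d: "range d = D"
    using D \<open>D \<noteq> {}\<close> by (simp add: d_def range_from_nat_into)
  \<comment> \<open>Stage \<open>Suc n\<close> absorbs the n-th point of a dense sequence, so the
    union of the stages has dense span.\<close>
  have "\<exists>E. \<forall>n. (orthonormal_on (E n) id \<and> finite (E n)) \<and>
      (E n \<subseteq> E (Suc n) \<and> d n \<in> complex_vector.span (E (Suc n)))"
  proof (rule dependent_nat_choice)
    show "\<exists>E::'a set. orthonormal_on E id \<and> finite E"
      by (rule exI[of _ "{}"]) (simp add: orthonormal_on_def)
  qed (use gram_schmidt_step in blast)
  then obtain E where E: "\<And>n. orthonormal_on (E n) id" "\<And>n. E n \<subseteq> E (Suc n)"
    "\<And>n. d n \<in> complex_vector.span (E (Suc n))"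
    by blast
  define B where "B = (\<Union>n. E n)"
  have "D \<subseteq> complex_vector.span B"
    using d E(3) complex_vector.span_mono[of "E _" B] by (fastforce simp: B_def)
  then have "closure (complex_vector.span B) = UNIV"
    using D(2) closure_mono by blast
  moreover have "orthonormal_on B id"
    unfolding orthonormal_on_def
  proof (intro ballI)
    fix x y assume "x \<in> B" "y \<in> B"
    then obtain m n where "x \<in> E m" "y \<in> E n"
      by (auto simp: B_def)
    then have "x \<in> E (max m n)" "y \<in> E (max m n)"
      using lift_Suc_mono_le[of E, OF E(2)] by (meson in_mono max.cobounded1 max.cobounded2)+
    then show "cinner (id x) (id y) = (if x = y then 1 else 0)"
      using E(1) orthonormal_onD by fastforce
  qed
  then have "(\<forall>e\<in>B. norm e = 1) \<and> (\<forall>e\<in>B. \<forall>f\<in>B. e \<noteq> f \<longrightarrow> cinner e f = 0)"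
    using orthonormal_on_norm[of B id] orthonormal_onD[of B id] by auto
  ultimately show ?thesis
    unfolding orthonormal_basis_def by (intro exI[of _ B] conjI) simp_all
qed

section \<open>Parseval expansion and the trace\<close>

text \<open>Choose y in the span close to x. Once a finite set G contains the support of y, the
  partial sum over G is the best approximation from the span of G, hence at least as close to x as y
  is.\<close>

lemma parseval_has_sum:
  assumes "orthonormal_basis B"
  shows "((\<lambda>b. cinner x b *\<^sub>C b) has_sum (x::'a::complex_inner)) B"
  unfolding has_sum_def tendsto_iff eventually_finite_subsets_at_top
proof (intro allI impI)
  fix \<epsilon> :: real assume "\<epsilon> > 0"
  have on: "orthonormal_on B id"
    using assms unfolding orthonormal_basis_def orthonormal_on_def by (simp add: cinner_self)
  have "x \<in> closure (complex_vector.span B)"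
    using assms unfolding orthonormal_basis_def by simp
  then obtain y where y: "y \<in> complex_vector.span B" "dist y x < \<epsilon>"
    using \<open>\<epsilon> > 0\<close> closure_approachable by blast
  from y(1) obtain F where F: "finite F" "F \<subseteq> B" "y \<in> complex_vector.span F"
    unfolding complex_vector.span_explicit
    by (fastforce intro: complex_vector.span_sum complex_vector.span_scale complex_vector.span_base)
  have "dist (\<Sum>b\<in>G. cinner x b *\<^sub>C b) x < \<epsilon>" if "finite G" "F \<subseteq> G" "G \<subseteq> B" for G
  proof -
    have "y \<in> complex_vector.span (id ` G)"
      using F(3) complex_vector.span_mono[OF that(2)] by auto
    then have "norm (x - proj G id x) \<le> norm (x - y)"
      using that orthonormal_on_subset[OF on] by (intro proj_best_approximation)
    then show ?thesis
      using y(2) unfolding proj_def dist_norm by (simp add: norm_minus_commute)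
  qed
  then show "\<exists>F. finite F \<and> F \<subseteq> B \<and>
      (\<forall>G. finite G \<and> F \<subseteq> G \<and> G \<subseteq> B \<longrightarrow> dist (\<Sum>b\<in>G. cinner x b *\<^sub>C b) x < \<epsilon>)"
    using F by blast
qed

text \<open>Apply the functional \<open>\<lambda>x. cinner x (f i)\<close> to the Parseval expansion
  of \<open>e i\<close>. As \<open>e\<close> and \<open>f\<close> are arbitrary families, the
  formula serves both |T| and the product of T with X.\<close>

lemma trace_op_finite_sum:
  assumes "separable_space (euclidean :: 'a::complex_inner topology)"
  shows "trace_op (\<lambda>x::'a. \<Sum>i\<in>I. cinner x (f i) *\<^sub>C e i) = (\<Sum>i\<in>I. cinner (e i) (f i))"
proof -
  define B :: "'a set" where "B = (SOME B. orthonormal_basis B)"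
  have B: "orthonormal_basis B"
    unfolding B_def by (rule someI_ex[OF orthonormal_basis_exists[OF assms]])
  have "((\<lambda>b. cinner b (f i) * cinner (e i) b) has_sum cinner (e i) (f i)) B" for i
    using has_sum_bounded_linear[OF bounded_linear_cinner_left[of "f i"] parseval_has_sum[OF B, of "e i"]]
    by (simp add: cinner_scaleC_left mult.commute o_def)
  then have "((\<lambda>b. \<Sum>i\<in>I. cinner b (f i) * cinner (e i) b) has_sum (\<Sum>i\<in>I. cinner (e i) (f i))) B"
    by (induction I rule: infinite_finite_induct) (auto intro: has_sum_add)
  then show ?thesis
    unfolding trace_op_def B_def[symmetric] cinner_sum_left cinner_scaleC_left
    by (rule infsumI)
qed

section \<open>Singular value decomposition\<close>

text \<open>Output vectors come before input vectors: \<open>op_sum n s f e\<close> is the adjoint,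
  and \<open>op_sum n s f f\<close> is diagonal when \<open>f\<close> is orthonormal.\<close>

definition op_sum :: "nat \<Rightarrow> (nat \<Rightarrow> real) \<Rightarrow> (nat \<Rightarrow> 'a) \<Rightarrow> (nat \<Rightarrow> 'a) \<Rightarrow> 'a \<Rightarrow> 'a::complex_inner" where
  "op_sum n s e f x = (\<Sum>i<n. (complex_of_real (s i) * cinner x (f i)) *\<^sub>C e i)"

text \<open>Strict positivity makes \<open>n\<close> the rank, so that the first \<open>n\<close>
  weights are exactly the list \<open>positive_singular_values T\<close>; the zero operator has
  \<open>n = 0\<close>.\<close>

definition svd :: "('a::complex_inner \<Rightarrow> 'a) \<Rightarrow> nat \<Rightarrow> (nat \<Rightarrow> real) \<Rightarrow> (nat \<Rightarrow> 'a) \<Rightarrow> (nat \<Rightarrow> 'a) \<Rightarrow> bool" where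
  "svd T n s e f \<longleftrightarrow> orthonormal_on {..<n} e \<and> orthonormal_on {..<n} f \<and> (\<forall>i<n. 0 < s i) \<and>
     (\<forall>i j. i \<le> j \<longrightarrow> j < n \<longrightarrow> s j \<le> s i) \<and> T = op_sum n s e f"

lemma bounded_opD:
  assumes "bounded_op T"
  shows "bounded_linear T" "T (c *\<^sub>C x) = c *\<^sub>C T x" "T (x + y) = T x + T y" "T (x - y) = T x - T y"
    "T 0 = 0"
  using assms by (auto simp: bounded_op_def bounded_linear.linear linear_add linear_diff linear_0)

lemma op_sum_apply:
  assumes "orthonormal_on {..<n} f" "j < n"
  shows "op_sum n s e f (f j) = complex_of_real (s j) *\<^sub>C e j"
proof -
  have "op_sum n s e f (f j) = (\<Sum>i<n. if i = j then complex_of_real (s i) *\<^sub>C e i else 0)"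
    unfolding op_sum_def using assms by (intro sum.cong) (auto simp: orthonormal_onD)
  then show ?thesis
    using assms by simp
qed

lemma cinner_op_sum:
  assumes "orthonormal_on {..<n} e" "j < n"
  shows "cinner (op_sum n s e f x) (e j) = complex_of_real (s j) * cinner x (f j)"
  unfolding op_sum_def using assms by (subst orthonormal_coefficient) auto

section \<open>Attainment of the operator norm\<close>

text \<open>A replacement for Heine-Borel inside a finite-dimensional subspace: each vector
  contributes the continuous image of a disc, and sums of compact sets are compact.\<close>

lemma compact_combinations:
  fixes E :: "'a::complex_inner set"
  assumes "finite E"
  shows "\<exists>K. compact K \<and> (\<forall>c. (\<forall>b\<in>E. cmod (c b) \<le> R) \<longrightarrow> (\<Sum>b\<in>E. c b *\<^sub>C b) \<in> K)"
  using assms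
proof (induction E)
  case empty
  show ?case
    by (rule exI[of _ "{0}"]) auto
next
  case (insert b E)
  then obtain K where K: "compact K" "\<And>c. (\<forall>b\<in>E. cmod (c b) \<le> R) \<Longrightarrow> (\<Sum>b\<in>E. c b *\<^sub>C b) \<in> K"
    by blast
  let ?L = "(\<lambda>c. c *\<^sub>C b) ` cball 0 R"
  have "compact ?L"
    by (intro compact_continuous_image linear_continuous_on bounded_linear_scaleC_left compact_cball)
  then have "compact {x + y |x y. x \<in> ?L \<and> y \<in> K}"
    using K(1) by (rule compact_sums)
  moreover have "(\<Sum>b\<in>insert b E. c b *\<^sub>C b) \<in> {x + y |x y. x \<in> ?L \<and> y \<in> K}"
    if "\<forall>b\<in>insert b E. cmod (c b) \<le> R" for c
    using that K(2)[of c] insert.hyps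
    by (intro CollectI exI[of _ "c b *\<^sub>C b"] exI[of _ "\<Sum>b\<in>E. c b *\<^sub>C b"]) auto
  ultimately show ?case
    by blast
qed

text \<open>Orthonormalising first is essential: only then does the norm of a vector bound its
  coefficients.\<close>

lemma compact_in_span:
  fixes B :: "'a::complex_inner set"
  assumes "finite B"
  shows "\<exists>K. compact K \<and> (\<forall>y\<in>complex_vector.span B. norm y \<le> R \<longrightarrow> y \<in> K)"
proof -
  obtain E where E: "orthonormal_on E id" "finite E"
      "complex_vector.span B \<subseteq> complex_vector.span (E::'a set)"
    using gram_schmidt[OF assms] by blast
  obtain K where K: "compact K" "\<And>c. (\<forall>b\<in>E. cmod (c b) \<le> R) \<Longrightarrow> (\<Sum>b\<in>E. c b *\<^sub>C b) \<in> K"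
    using compact_combinations[OF E(2)] by blast
  have "y \<in> K" if y: "y \<in> complex_vector.span B" "norm y \<le> R" for y
  proof -
    have "cmod (cinner y b) \<le> R" if "b \<in> E" for b
      using cmod_cinner_le[of y b] orthonormal_on_norm[OF E(1) that] y(2) by simp
    then have "proj E id y \<in> K"
      unfolding proj_def using K(2)[of "cinner y"] by simp
    then show ?thesis
      using proj_eq[OF E(1,2), of y] E(3) y(1) by auto
  qed
  then show ?thesis
    using K(1) by blast
qed

text \<open>A maximising sequence of unit vectors, chosen such that its image converges, is itself Cauchy
  by the parallelogram law.\<close>

lemma finite_rank_norm_attained:
  fixes T :: "'a::complex_hilbert \<Rightarrow> 'a"
  assumes T: "bounded_op T" and B: "finite B" "range T \<subseteq> complex_vector.span B" and "0 < onorm T"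
  obtains f where "norm f = 1" "norm (T f) = onorm T"
proof -
  define S where "S = onorm T"
  have "S > 0"
    using assms(4) by (simp add: S_def)
  have bl: "bounded_linear T"
    using T by (rule bounded_opD)
  have le: "norm (T x) \<le> S * norm x" for x
    unfolding S_def by (rule onorm[OF bl])
  have "\<exists>x. norm x = 1 \<and> norm (T x) > S * (1 - 1 / real (Suc n))" for n
  \<comment> \<open>If all unit vectors stayed below this value, then by homogeneity
    \<open>onorm_bound\<close> would give an operator norm smaller than \<open>S\<close>.\<close>
  proof (rule ccontr)
    assume "\<not> ?thesis"
    then have *: "norm (T x) \<le> S * (1 - 1 / real (Suc n))" if "norm x = 1" for x
      using that not_less by blast
    have "norm (T x) \<le> S * (1 - 1 / real (Suc n)) * norm x" for x
    proof (cases "x = 0")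
      case False
      then have "norm (x /\<^sub>R norm x) = 1"
        by simp
      then have "norm (T (x /\<^sub>R norm x)) \<le> S * (1 - 1 / real (Suc n))"
        by (rule *)
      then show ?thesis
        using False by (simp add: linear_scale bounded_linear.linear[OF bl] field_simps)
    qed (use bounded_opD(5)[OF T] in simp)
    then have "S \<le> S * (1 - 1 / real (Suc n))"
      unfolding S_def by (intro onorm_bound) (use assms(4) in auto)
    then show False
      using \<open>S > 0\<close> by (simp add: field_simps)
  qed
  then have "\<forall>n. \<exists>x. norm x = 1 \<and> norm (T x) > S * (1 - 1 / real (Suc n))"
    by (rule allI)
  from choice[OF this] obtain x
    where x: "\<And>n. norm (x n) = 1" "\<And>n. norm (T (x n)) > S * (1 - 1 / real (Suc n))"
    by blast
  obtain K where K: "compact K" "\<And>y. y \<in> complex_vector.span B \<Longrightarrow> norm y \<le> S \<Longrightarrow> y \<in> K"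
    using compact_in_span[OF B(1), of S] by blast
  have "\<forall>n. T (x n) \<in> K"
    using K(2) B(2) le[of "x _"] x(1) by auto
  then obtain y r where r: "strict_mono r" and lim: "((T \<circ> x) \<circ> r) \<longlonglongrightarrow> y"
    using K(1) unfolding compact_eq_seq_compact_metric seq_compact_def by (metis o_apply)
  have "(\<lambda>n. norm (T (x n))) \<longlonglongrightarrow> S"
  proof (rule tendsto_sandwich)
    show "(\<lambda>n. S * (1 - 1 / real (Suc n))) \<longlonglongrightarrow> S"
      using tendsto_mult[OF tendsto_const tendsto_diff[OF tendsto_const LIMSEQ_inverse_real_of_nat], of S 1]
      by (simp add: inverse_eq_divide)
    show "\<forall>\<^sub>F n in sequentially. S * (1 - 1 / real (Suc n)) \<le> norm (T (x n))"
      using x(2) by (intro always_eventually) (auto intro: less_imp_le)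
    show "\<forall>\<^sub>F n in sequentially. norm (T (x n)) \<le> S"
      using le[of "x _"] x(1) by (intro always_eventually) auto
  qed auto
  from LIMSEQ_subseq_LIMSEQ[OF this r] tendsto_norm[OF lim] have "norm y = S"
    by (auto simp: o_def intro: LIMSEQ_unique)
  \<comment> \<open>Dividing by \<open>S\<close> converts distances between images into the scale of
    the vectors \<open>x (r n)\<close>.\<close>
  define \<delta> where "\<delta> n = norm (T (x (r n)) - y) / S" for n
  have "\<delta> \<longlonglongrightarrow> 0"
    using tendsto_divide[OF tendsto_norm[OF tendsto_diff[OF lim tendsto_const[of y]]] tendsto_const[of S]]
      \<open>S > 0\<close> by (simp add: \<delta>_def [abs_def] o_def)
  \<comment> \<open>The image of x_m + x_n is close to 2y, which has norm 2S, so x_m + x_n has norm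
    at least 2 - d. The parallelogram law then leaves at most 4 - (2 - d)^2 <= 4d for the
    difference.\<close>
  have close: "(norm (x (r m) - x (r n)))\<^sup>2 \<le> 4 * (\<delta> m + \<delta> n)" for m n
  proof -
    define d where "d = \<delta> m + \<delta> n"
    have "2 * S = norm (2 *\<^sub>R y)"
      using \<open>norm y = S\<close> by simp
    also have "2 *\<^sub>R y = T (x (r m) + x (r n)) - (T (x (r m)) - y) - (T (x (r n)) - y)"
      by (simp add: bounded_opD(3)[OF T] scaleR_2)
    also have "norm \<dots> \<le> norm (T (x (r m) + x (r n))) + norm (T (x (r m)) - y) + norm (T (x (r n)) - y)"
      by norm
    also have "\<dots> \<le> S * norm (x (r m) + x (r n)) + S * d"
      using le[of "x (r m) + x (r n)"] \<open>S > 0\<close> by (simp add: d_def \<delta>_def field_simps)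
    finally have "S * 2 \<le> S * (norm (x (r m) + x (r n)) + d)"
      by (simp add: algebra_simps)
    then have "2 - d \<le> norm (x (r m) + x (r n))"
      using \<open>S > 0\<close> by simp
    \<comment> \<open>Squaring needs 2 - d >= 0; for larger d the right-hand side already exceeds
      4.\<close>
    have "4 - (norm (x (r m) + x (r n)))\<^sup>2 \<le> 4 * d"
    proof (cases "d \<le> 2")
      case True
      then have "(2 - d)\<^sup>2 \<le> (norm (x (r m) + x (r n)))\<^sup>2"
        using \<open>2 - d \<le> _\<close> by (intro power_mono) auto
      moreover have "4 - (2 - d)\<^sup>2 \<le> 4 * d"
        by (simp add: power2_eq_square algebra_simps)
      ultimately show ?thesis
        by linarith
    next
      case False
      then show ?thesis
        using zero_le_power2[of "norm (x (r m) + x (r n))"] by linarith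
    qed
    moreover have "(norm (x (r m) - x (r n)))\<^sup>2 + (norm (x (r m) + x (r n)))\<^sup>2 = 4"
      using x(1)[of "r m"] x(1)[of "r n"]
      by (simp add: power2_norm_eq_inner inner_add inner_diff inner_commute norm_eq_1)
    ultimately show ?thesis
      by (simp add: d_def)
  qed
  have "Cauchy (x \<circ> r)"
  proof (rule metric_CauchyI)
    fix \<epsilon> :: real assume "\<epsilon> > 0"
    then have "\<forall>\<^sub>F n in sequentially. \<delta> n < \<epsilon>\<^sup>2 / 8"
      using order_tendstoD(2)[OF \<open>\<delta> \<longlonglongrightarrow> 0\<close>, of "\<epsilon>\<^sup>2 / 8"] by simp
    then obtain N where N: "\<And>n. n \<ge> N \<Longrightarrow> \<delta> n < \<epsilon>\<^sup>2 / 8"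
      unfolding eventually_sequentially by blast
    have "dist ((x \<circ> r) m) ((x \<circ> r) n) < \<epsilon>" if "m \<ge> N" "n \<ge> N" for m n
    proof (rule power2_less_imp_less)
      show "(dist ((x \<circ> r) m) ((x \<circ> r) n))\<^sup>2 < \<epsilon>\<^sup>2"
        using close[of m n] N[OF that(1)] N[OF that(2)] by (simp add: dist_norm)
    qed (use \<open>\<epsilon> > 0\<close> in simp)
    then show "\<exists>N. \<forall>m\<ge>N. \<forall>n\<ge>N. dist ((x \<circ> r) m) ((x \<circ> r) n) < \<epsilon>"
      by blast
  qed
  then obtain f where f: "(x \<circ> r) \<longlonglongrightarrow> f"
    using Cauchy_convergent convergent_def by blast
  have "(\<lambda>n. norm ((x \<circ> r) n)) \<longlonglongrightarrow> 1"
    using x(1) by simp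
  with tendsto_norm[OF f] have "norm f = 1"
    by (rule LIMSEQ_unique)
  moreover have "(\<lambda>n. T ((x \<circ> r) n)) \<longlonglongrightarrow> T f"
    using bl f by (rule bounded_linear.tendsto)
  with lim have "T f = y"
    by (auto simp: o_def intro: LIMSEQ_unique)
  ultimately show ?thesis
    using that \<open>norm y = S\<close> S_def by blast
qed

text \<open>First variation: moving from f to f + t z with z orthogonal to f changes |f|^2 only to
  second order in t, so the first order term 2 t a of |T (f + t z)|^2 must vanish.\<close>

lemma orthogonal_to_maximiser:
  assumes T: "bounded_op T" and f: "norm f = 1" "norm (T f) = onorm T" and x: "cinner x f = 0"
  shows "cinner (T x) (T f) = 0"
proof -
  have real_case: "inner (T z) (T f) = 0" if "inner z f = 0" for z
  proof -
    define a where "a = inner (T z) (T f)"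
    define M where "M = (onorm T)\<^sup>2 * (norm z)\<^sup>2"
    have bound: "2 * t * a \<le> M * t\<^sup>2" for t
    proof -
      have "(norm (T (f + t *\<^sub>R z)))\<^sup>2 \<le> (onorm T * norm (f + t *\<^sub>R z))\<^sup>2"
        by (intro power_mono onorm bounded_opD(1)[OF T]) auto
      moreover have "T (f + t *\<^sub>R z) = T f + t *\<^sub>R T z"
        by (metis bounded_opD(2,3)[OF T] scaleC_of_real)
      moreover have "(norm (T f + t *\<^sub>R T z))\<^sup>2 = (norm (T f))\<^sup>2 + 2 * t * a + t\<^sup>2 * (norm (T z))\<^sup>2"
        unfolding power2_norm_eq_inner
        by (simp add: a_def inner_add inner_commute power2_eq_square algebra_simps)
      moreover have "(norm (f + t *\<^sub>R z))\<^sup>2 = (norm f)\<^sup>2 + t\<^sup>2 * (norm z)\<^sup>2"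
        unfolding power2_norm_eq_inner using that
        by (simp add: inner_add inner_commute power2_eq_square algebra_simps)
      ultimately have "2 * t * a + t\<^sup>2 * (norm (T z))\<^sup>2 \<le> M * t\<^sup>2"
        using f by (simp add: M_def power_mult_distrib algebra_simps)
      moreover have "0 \<le> t\<^sup>2 * (norm (T z))\<^sup>2"
        by simp
      ultimately show ?thesis
        by linarith
    qed
    have "M \<ge> 0"
      by (simp add: M_def)
    \<comment> \<open>With t = u the linear term 2 u a = 2 (M + 1) u^2 beats M u^2 unless u = 0;
      adding 1 keeps the denominator positive.\<close>
    define u where "u = a / (M + 1)"
    have a: "a = u * (M + 1)"
      using \<open>M \<ge> 0\<close> by (simp add: u_def)
    have "(M + 2) * u\<^sup>2 \<le> 0"
      using bound[of u] unfolding a by (simp add: algebra_simps power2_eq_square)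
    then have "a = 0"
      using \<open>M \<ge> 0\<close> by (simp add: a mult_le_0_iff)
    then show ?thesis
      by (simp add: a_def)
  qed
  have "inner (T x) (T f) = 0"
    using x by (intro real_case) (simp add: inner_eq_Re_cinner)
  \<comment> \<open>The real case sees only real parts; multiplying x by \<i> exposes the imaginary
    part.\<close>
  moreover have "inner (T (\<i> *\<^sub>C x)) (T f) = 0"
    using x by (intro real_case) (simp add: inner_eq_Re_cinner cinner_scaleC_left)
  ultimately show ?thesis
    by (simp add: inner_eq_Re_cinner bounded_opD(2)[OF T] cinner_scaleC_left complex_eq_iff)
qed

section \<open>Deflation and existence of the decomposition\<close>

text \<open>One Steinitz exchange. If \<open>e\<close> is not in the span of the smaller set, then
  the newly inserted vector itself can be exchanged.\<close>

lemma exchange_one: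
  assumes "finite B" "e \<in> complex_vector.span B" "e \<noteq> (0::'a::complex_inner)"
  shows "\<exists>b\<in>B. b \<in> complex_vector.span (insert e (B - {b}))"
  using assms
proof (induction B)
  case (insert a B)
  show ?case
  proof (cases "e \<in> complex_vector.span B")
    case True
    then obtain b where b: "b \<in> B" "b \<in> complex_vector.span (insert e (B - {b}))"
      using insert by blast
    have "insert e (B - {b}) \<subseteq> insert e (insert a B - {b})"
      by blast
    from complex_vector.span_mono[OF this] show ?thesis
      using b by blast
  next
    case False
    then have "a \<in> complex_vector.span (insert e B)"
      using complex_vector.in_span_insert insert.prems(1) by blast
    then show ?thesis
      using insert.hyps by simp
  qed
qed simp

text \<open>Rank is measured by the size of a spanning set. Exchange some b for e, then project e
  out: e itself becomes 0, the other vectors give at most card B - 1 images, and vectors orthogonal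
  to e are unchanged.\<close>

lemma orthogonal_complement_in_span:
  assumes B: "finite B" and e: "e \<in> complex_vector.span B" "norm (e::'a::complex_inner) = 1"
  obtains B' where "finite B'" "card B' < card B"
    "\<And>y. y \<in> complex_vector.span B \<Longrightarrow> cinner y e = 0 \<Longrightarrow> y \<in> complex_vector.span B'"
proof -
  have "e \<noteq> 0"
    using e(2) by auto
  then obtain b where b: "b \<in> B" "b \<in> complex_vector.span (insert e (B - {b}))"
    using exchange_one[OF B e(1)] by blast
  define P where "P y = y - cinner y e *\<^sub>C e" for y
  define B' where "B' = P ` (B - {b})"
  have "P e = 0"
    using e(2) by (simp add: P_def cinner_self)
  have P_span: "P y \<in> complex_vector.span B'" if "y \<in> complex_vector.span (insert e (B - {b}))" for y
    using that
  proof (induction rule: complex_vector.span_induct_alt)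
    case base
    show ?case
      by (simp add: P_def complex_vector.span_zero)
  next
    case (step c x y)
    have "P x \<in> complex_vector.span B'"
      using step(1) \<open>P e = 0\<close> by (auto simp: B'_def complex_vector.span_zero intro: complex_vector.span_base)
    moreover have "P (c *\<^sub>C x + y) = c *\<^sub>C P x + P y"
      by (simp add: P_def cinner_add_left cinner_scaleC_left complex_vector.scale_right_diff_distrib
          scaleC_scaleC scaleC_add_left)
    ultimately show ?case
      using step(2) by (simp add: complex_vector.span_add complex_vector.span_scale)
  qed
  have "B \<subseteq> complex_vector.span (insert e (B - {b}))"
    using b complex_vector.span_superset[of "insert e (B - {b})"] by auto
  then have span: "complex_vector.span B \<subseteq> complex_vector.span (insert e (B - {b}))"
    using complex_vector.span_minimal complex_vector.subspace_span by blast
  show ?thesis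
  proof
    show "finite B'"
      using B by (simp add: B'_def)
    have "card B' \<le> card (B - {b})"
      using B unfolding B'_def by (intro card_image_le) simp
    then show "card B' < card B"
      using card_Diff1_less[OF B b(1)] by linarith
    show "y \<in> complex_vector.span B'" if "y \<in> complex_vector.span B" "cinner y e = 0" for y
      using P_span[of y] that span by (auto simp: P_def)
  qed
qed

lemma bounded_op_op_sum: "bounded_op (op_sum n s e f)"
proof -
  have "bounded_linear (\<lambda>x. (complex_of_real (s i) * cinner x (f i)) *\<^sub>C e i)" for i
    by (intro bounded_linear_compose[OF bounded_linear_scaleC_left]
        bounded_linear_compose[OF bounded_linear_mult_right] bounded_linear_cinner_left)
  then have "bounded_linear (op_sum n s e f)"
    unfolding op_sum_def [abs_def] by (intro bounded_linear_sum)
  then show ?thesis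
    unfolding bounded_op_def op_sum_def
    by (simp add: cinner_scaleC_left complex_vector.scale_sum_right scaleC_scaleC mult.left_commute)
qed

text \<open>The deflated operator is T after the projection q away from f. So it kills f and its
  values are orthogonal to e, which makes the new vectors orthogonal to the old ones; and as q is a
  contraction, the old weights are at most \<open>onorm T\<close>, so the new weight goes in
  front.\<close>

lemma svd_Suc:
  assumes T: "bounded_op T" and f: "norm f = 1" "norm (T f) = onorm T" and pos: "0 < onorm T"
    and e: "e = complex_of_real (1 / onorm T) *\<^sub>C T f"
    and svd: "svd (\<lambda>x. T x - (complex_of_real (onorm T) * cinner x f) *\<^sub>C e) n s e' f'"
  shows "svd T (Suc n) (case_nat (onorm T) s) (case_nat e e') (case_nat f f')"
proof -
  define S where "S = onorm T"
  define T' where "T' x = T x - (complex_of_real S * cinner x f) *\<^sub>C e" for x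
  have "S > 0"
    using pos by (simp add: S_def)
  have T': "T' = op_sum n s e' f'" and orth: "orthonormal_on {..<n} e'" "orthonormal_on {..<n} f'"
    and s: "\<And>i. i < n \<Longrightarrow> 0 < s i" "\<And>i j. i \<le> j \<Longrightarrow> j < n \<Longrightarrow> s j \<le> s i"
    using svd unfolding svd_def T'_def [abs_def] S_def by blast+
  have ff: "cinner f f = 1"
    using f(1) by (simp add: cinner_self)
  have "norm e = 1"
    using f pos by (simp add: e norm_divide)
  then have ee: "cinner e e = 1"
    by (simp add: cinner_self)
  have Tf: "T f = complex_of_real S *\<^sub>C e"
    using \<open>S > 0\<close> by (simp add: e S_def scaleC_scaleC)
  define q where "q x = x - cinner x f *\<^sub>C f" for x
  have qf: "cinner (q x) f = 0" for x
    by (simp add: q_def cinner_diff_left cinner_scaleC_left ff)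
  have T'q: "T' x = T (q x)" for x
    by (simp add: T'_def q_def bounded_opD[OF T] Tf scaleC_scaleC mult.commute)
  have "cinner (T (q x)) (T f) = 0" for x
    using orthogonal_to_maximiser[OF T f qf] .
  then have T'e: "cinner (T' x) e = 0" for x
    unfolding T'q Tf cinner_scaleC_right using \<open>S > 0\<close> by simp
  have T'f: "T' f = 0"
    by (simp add: T'_def Tf ff)
  have e'e: "cinner (e' i) e = 0" if "i < n" for i
    using T'e[of "f' i"] s(1)[OF that] op_sum_apply[OF orth(2) that, of s e']
    by (simp add: T' cinner_scaleC_left)
  have ff': "cinner f (f' i) = 0" if "i < n" for i
    using cinner_op_sum[OF orth(1) that, of s f' f] s(1)[OF that] T'f by (simp add: T')
  have ee': "cinner e (e' i) = 0" "cinner (f' i) f = 0" if "i < n" for i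
    using e'e[OF that] ff'[OF that] cinner_commute[of e "e' i"] cinner_commute[of "f' i" f] by auto
  have sS: "s i \<le> S" if "i < n" for i
  proof -
    have "(norm (f' i))\<^sup>2 = (norm (q (f' i)))\<^sup>2 + (norm (cinner (f' i) f *\<^sub>C f))\<^sup>2"
      using norm_add_orthogonal[of "q (f' i)" "cinner (f' i) f *\<^sub>C f"] qf[of "f' i"]
      by (simp add: cinner_scaleC_right q_def)
    then have "(norm (q (f' i)))\<^sup>2 \<le> 1\<^sup>2"
      using orthonormal_on_norm[OF orth(2), unfolded lessThan_iff, OF that]
        zero_le_power2[of "norm (cinner (f' i) f *\<^sub>C f)"]
      by (simp del: norm_scaleC zero_le_power2; linarith)
    then have "norm (q (f' i)) \<le> 1"
      by (rule power2_le_imp_le) simp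
    have "s i = norm (T' (f' i))"
      using op_sum_apply[OF orth(2) that, of s e'] orthonormal_on_norm[OF orth(1), of i] that s(1)[OF that]
      by (simp add: T')
    also have "\<dots> \<le> S * norm (q (f' i))"
      unfolding T'q S_def by (rule onorm[OF bounded_opD(1)[OF T]])
    also have "\<dots> \<le> S"
      using \<open>norm (q (f' i)) \<le> 1\<close> \<open>S > 0\<close> by (simp add: mult_left_le)
    finally show ?thesis .
  qed
  have "orthonormal_on {..<Suc n} (case_nat e e')"
    using orth(1) ee e'e ee' by (auto simp: orthonormal_on_def split: nat.splits)
  moreover have "orthonormal_on {..<Suc n} (case_nat f f')"
    using orth(2) ff ff' ee' by (auto simp: orthonormal_on_def split: nat.splits)
  moreover have "T = op_sum (Suc n) (case_nat S s) (case_nat e e') (case_nat f f')"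
  proof
    fix x
    have "T x = (complex_of_real S * cinner x f) *\<^sub>C e + T' x"
      by (simp add: T'_def)
    then show "T x = op_sum (Suc n) (case_nat S s) (case_nat e e') (case_nat f f') x"
      unfolding T' op_sum_def by (subst sum.lessThan_Suc_shift) simp
  qed
  ultimately show ?thesis
    unfolding svd_def S_def[symmetric] using s sS \<open>S > 0\<close> by (auto split: nat.splits)
qed

text \<open>Strong induction on the size of a set spanning the range, because deflation lowers this
  size by at least one.\<close>

lemma svd_exists:
  fixes T :: "'a::complex_hilbert \<Rightarrow> 'a"
  assumes "T \<in> finite_rank_ops"
  shows "\<exists>n s e f. svd T n s e f"
proof -
  have "\<exists>n s e f. svd T n s e f"
    if "bounded_op T" "finite B" "range T \<subseteq> complex_vector.span B" "card B = d"
    for T :: "'a \<Rightarrow> 'a" and B d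
    using that
  proof (induction d arbitrary: T B rule: less_induct)
    case (less d)
    show ?case
    proof (cases "onorm T = 0")
      case True
      then have "svd T 0 (\<lambda>_. 0) (\<lambda>_. 0) (\<lambda>_. 0)"
        using onorm_eq_0[OF bounded_opD(1)[OF less.prems(1)]]
        by (auto simp: svd_def orthonormal_on_def op_sum_def)
      then show ?thesis
        by blast
    next
      case False
      then have pos: "0 < onorm T"
        using onorm_pos_le[OF bounded_opD(1)[OF less.prems(1)]] by simp
      obtain f where f: "norm f = 1" "norm (T f) = onorm T"
        using finite_rank_norm_attained[OF less.prems(1-3) pos] by blast
      define e where "e = complex_of_real (1 / onorm T) *\<^sub>C T f"
      define T' where "T' x = T x - (complex_of_real (onorm T) * cinner x f) *\<^sub>C e" for x
      have Tf: "T f = complex_of_real (onorm T) *\<^sub>C e"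
        using pos by (simp add: e_def scaleC_scaleC)
      have "norm e = 1"
        using f pos by (simp add: e_def norm_divide)
      have e_in: "e \<in> complex_vector.span B"
        using less.prems(3) by (auto simp: e_def intro: complex_vector.span_scale)
      obtain B' where B': "finite B'" "card B' < card B"
        "\<And>y. y \<in> complex_vector.span B \<Longrightarrow> cinner y e = 0 \<Longrightarrow> y \<in> complex_vector.span B'"
        using orthogonal_complement_in_span[OF less.prems(2) e_in \<open>norm e = 1\<close>] by blast
      have "T' x \<in> complex_vector.span B'" for x
      proof (rule B'(3))
        show "T' x \<in> complex_vector.span B"
          using less.prems(3) e_in
          by (auto simp: T'_def intro: complex_vector.span_diff complex_vector.span_scale)
        have "T' x = T (x - cinner x f *\<^sub>C f)"
          by (simp add: T'_def bounded_opD[OF less.prems(1)] Tf scaleC_scaleC mult.commute)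
        moreover have "cinner (x - cinner x f *\<^sub>C f) f = 0"
          using f(1) by (simp add: cinner_diff_left cinner_scaleC_left cinner_self)
        ultimately have "cinner (T' x) (T f) = 0"
          using orthogonal_to_maximiser[OF less.prems(1) f] by simp
        then show "cinner (T' x) e = 0"
          by (simp add: e_def cinner_scaleC_right)
      qed
      moreover have "bounded_op T'"
        unfolding bounded_op_def T'_def
        by (auto simp: bounded_opD[OF less.prems(1)] cinner_scaleC_left scaleC_scaleC mult.left_commute
            complex_vector.scale_right_diff_distrib
            intro!: bounded_linear_sub bounded_linear_compose[OF bounded_linear_scaleC_left]
              bounded_linear_compose[OF bounded_linear_mult_right] bounded_linear_cinner_left)
      ultimately obtain n s e' f' where "svd T' n s e' f'"
        using less.IH[of "card B'" T' B'] B' less.prems(4) by blast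
      then show ?thesis
        using svd_Suc[OF less.prems(1) f pos e_def, of n s e' f'] unfolding T'_def by blast
    qed
  qed
  then show ?thesis
    using assms unfolding finite_rank_ops_def by blast
qed

section \<open>Singular values and trace norm\<close>

text \<open>The explicit formula supplies existence, and \<open>cinner_ext\<close> supplies the
  uniqueness that \<open>THE\<close> requires.\<close>

lemma adjoint_op_sum: "adjoint_op (op_sum n s e f) = op_sum n s f e"
  unfolding adjoint_op_def
proof (rule the_equality)
  have eq: "cinner (op_sum n s e f x) y = cinner x (op_sum n s f e y)" for x y
    unfolding op_sum_def cinner_sum_left cinner_sum_right cinner_scaleC_left cinner_scaleC_right
    by (intro sum.cong refl) (simp add: cinner_commute[of _ y])
  then show "\<forall>x y. cinner (op_sum n s e f x) y = cinner x (op_sum n s f e y)"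
    by blast
  show "S = op_sum n s f e" if "\<forall>x y. cinner (op_sum n s e f x) y = cinner x (S y)" for S
    using that eq by (intro ext cinner_ext) simp
qed

lemma op_sum_op_sum:
  assumes "orthonormal_on {..<n} e"
  shows "op_sum n t g e (op_sum n s e f x) = op_sum n (\<lambda>i. t i * s i) g f x"
proof -
  have "op_sum n t g e (op_sum n s e f x)
      = (\<Sum>i<n. (complex_of_real (t i) * cinner (op_sum n s e f x) (e i)) *\<^sub>C g i)"
    by (simp only: op_sum_def[of n t])
  also have "\<dots> = op_sum n (\<lambda>i. t i * s i) g f x"
    unfolding op_sum_def[of n "\<lambda>i. t i * s i"]
    using cinner_op_sum[OF assms, of _ s f x] by (intro sum.cong refl) (simp add: mult.assoc)
  finally show ?thesis .
qed

text \<open>Positivity only at \<open>x + y\<close> and \<open>x + \<i> y\<close> is needed, since it is the imaginary parts of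
  the polarisation identity that give symmetry.\<close>

lemma positive_op_symmetric:
  assumes "positive_op P"
  shows "cinner (P x) y = cinner x (P y)"
proof -
  have P: "bounded_op P" and im: "Im (cinner (P z) z) = 0" for z
    using assms unfolding positive_op_def by (auto simp: complex_nonneg_Reals_iff)
  have "Im (cinner (P x) y) + Im (cinner (P y) x) = 0"
    using im[of "x + y"] im[of x] im[of y]
    by (simp add: bounded_opD(3)[OF P] cinner_add_left cinner_add_right)
  moreover have "Re (cinner (P y) x) - Re (cinner (P x) y) = 0"
    using im[of "x + \<i> *\<^sub>C y"] im[of x] im[of y]
    by (simp add: bounded_opD(2,3)[OF P] cinner_add_left cinner_add_right cinner_scaleC_left
        cinner_scaleC_right)
  ultimately show ?thesis
    using cinner_commute[of x "P y"] by (simp add: complex_eq_iff)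
qed

lemma positive_op_sum:
  assumes "\<And>i. i < n \<Longrightarrow> 0 \<le> s i"
  shows "positive_op (op_sum n s f f)"
proof -
  have "cinner (op_sum n s f f x) x = complex_of_real (\<Sum>i<n. s i * (cmod (cinner x (f i)))\<^sup>2)" for x
    unfolding op_sum_def cinner_sum_left cinner_scaleC_left of_real_sum of_real_mult complex_norm_square
    by (intro sum.cong refl) (simp add: cinner_commute[of "f _" x])
  moreover have "0 \<le> (\<Sum>i<n. s i * (cmod (cinner x (f i)))\<^sup>2)" for x
    using assms by (intro sum_nonneg) simp
  ultimately show ?thesis
    unfolding positive_op_def by (simp add: bounded_op_op_sum del: of_real_sum of_real_mult of_real_power)
qed

text \<open>For v = P f_j - s_j f_j one has (P + s_j) v = (P^2 - s_j^2) f_j = 0, so v would be an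
  eigenvector for -s_j < 0, and positivity forces v = 0. For y orthogonal to all f_j, P^2 y = 0 and
  symmetry give |P y|^2 = 0.\<close>

lemma positive_square_root_unique:
  assumes f: "orthonormal_on {..<n} f" and s: "\<And>i. i < n \<Longrightarrow> 0 < s i"
    and P: "positive_op P" and sq: "P \<circ> P = op_sum n (\<lambda>i. s i * s i) f f"
  shows "P = op_sum n s f f"
proof
  fix x
  have bP: "bounded_op P" and pos: "\<And>x. cinner (P x) x \<in> \<real>\<^sub>\<ge>\<^sub>0"
    using P by (auto simp: positive_op_def)
  have PP: "P (P z) = op_sum n (\<lambda>i. s i * s i) f f z" for z
    using fun_cong[OF sq, of z] by simp
  have Pf: "P (f j) = complex_of_real (s j) *\<^sub>C f j" if j: "j < n" for j
  proof -
    define v where "v = P (f j) - complex_of_real (s j) *\<^sub>C f j"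
    have "P v = - complex_of_real (s j) *\<^sub>C v"
      unfolding v_def
      by (simp add: bounded_opD[OF bP] PP op_sum_apply[OF f j] complex_vector.scale_right_diff_distrib
          scaleC_scaleC)
    then have "cinner (P v) v = - complex_of_real (s j) * complex_of_real ((norm v)\<^sup>2)"
      by (simp add: cinner_scaleC_left cinner_self del: of_real_power flip: of_real_minus)
    then have "0 \<le> - (s j * (norm v)\<^sup>2)"
      using pos[of v] by (simp add: complex_nonneg_Reals_iff del: of_real_power)
    then have "v = 0"
      using s[OF j] by (simp add: mult_le_0_iff)
    then show ?thesis
      by (simp add: v_def)
  qed
  define y where "y = x - proj {..<n} f x"
  have "op_sum n (\<lambda>i. s i * s i) f f y = 0"
    unfolding op_sum_def y_def using cinner_diff_proj[OF f] by simp
  then have "cinner (P y) (P y) = 0"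
    using positive_op_symmetric[OF P, of y "P y"] by (simp add: PP)
  then have "P y = 0"
    by simp
  then have "P x = P (proj {..<n} f x)"
    by (simp add: y_def bounded_opD(4)[OF bP])
  also have "\<dots> = (\<Sum>i<n. P (cinner x (f i) *\<^sub>C f i))"
    unfolding proj_def using linear_sum[OF bounded_linear.linear[OF bounded_opD(1)[OF bP]]] .
  also have "\<dots> = op_sum n s f f x"
    unfolding op_sum_def
    by (intro sum.cong refl) (simp add: bounded_opD(2)[OF bP] Pf scaleC_scaleC mult.commute)
  finally show "P x = op_sum n s f f x" .
qed

lemma abs_op_svd:
  assumes "svd T n s e f"
  shows "abs_op T = op_sum n s f f"
proof -
  have e: "orthonormal_on {..<n} e" and f: "orthonormal_on {..<n} f"
    and s: "\<And>i. i < n \<Longrightarrow> 0 < s i" and T: "T = op_sum n s e f"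
    using assms unfolding svd_def by blast+
  have eq: "adjoint_op T \<circ> T = op_sum n (\<lambda>i. s i * s i) f f"
    unfolding T adjoint_op_sum by (simp add: fun_eq_iff op_sum_op_sum[OF e])
  show ?thesis
    unfolding abs_op_def eq
  proof (rule the_equality)
    show "positive_op (op_sum n s f f) \<and> op_sum n s f f \<circ> op_sum n s f f = op_sum n (\<lambda>i. s i * s i) f f"
      using s by (simp add: positive_op_sum less_imp_le fun_eq_iff op_sum_op_sum[OF f])
    show "P = op_sum n s f f" if "positive_op P \<and> P \<circ> P = op_sum n (\<lambda>i. s i * s i) f f" for P
      using positive_square_root_unique[where s = s and P = P, OF f s] that by blast
  qed
qed

text \<open>Comparing coefficients kills those with s_i distinct from \<sigma>. Positivity of
  \<sigma> then puts x = P x / \<sigma> in the span; for \<sigma> = 0 the orthogonal complement of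
  the f_i would enter as well.\<close>

lemma eigenspace_op_sum:
  assumes f: "orthonormal_on {..<n} f" and "\<sigma> > 0"
  shows "eigenspace (op_sum n s f f) \<sigma> = complex_vector.span (f ` {i. i < n \<and> s i = \<sigma>})"
    (is "?E = complex_vector.span ?F")
proof
  show "?E \<subseteq> complex_vector.span ?F"
  proof
    fix x assume "x \<in> ?E"
    then have x: "op_sum n s f f x = complex_of_real \<sigma> *\<^sub>C x"
      by (simp add: eigenspace_def)
    have *: "complex_of_real \<sigma> * cinner x (f j) = complex_of_real (s j) * cinner x (f j)" if "j < n" for j
      using cinner_op_sum[OF f that, of s f x] by (simp add: x cinner_scaleC_left)
    have "(complex_of_real (s i) * cinner x (f i)) *\<^sub>C f i \<in> complex_vector.span ?F" if "i < n" for i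
    proof (cases "s i = \<sigma>")
      case True
      then have "f i \<in> ?F"
        using that by blast
      then show ?thesis
        by (intro complex_vector.span_scale complex_vector.span_base)
    next
      case False
      then have "cinner x (f i) = 0"
        using * [OF that] by auto
      then show ?thesis
        by (simp add: complex_vector.span_zero)
    qed
    then have "op_sum n s f f x \<in> complex_vector.span ?F"
      unfolding op_sum_def by (intro complex_vector.span_sum) simp
    then have "complex_of_real (1 / \<sigma>) *\<^sub>C (complex_of_real \<sigma> *\<^sub>C x) \<in> complex_vector.span ?F"
      unfolding x by (rule complex_vector.span_scale)
    then show "x \<in> complex_vector.span ?F"
      using \<open>\<sigma> > 0\<close> by (simp add: scaleC_scaleC)
  qed
  show "complex_vector.span ?F \<subseteq> ?E"
  proof
    fix x assume "x \<in> complex_vector.span ?F"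
    then show "x \<in> ?E"
    proof (induction rule: complex_vector.span_induct_alt)
      case base
      show ?case
        by (simp add: eigenspace_def bounded_opD(5)[OF bounded_op_op_sum])
    next
      case (step c x y)
      then show ?case
        by (auto simp: eigenspace_def bounded_opD(2,3)[OF bounded_op_op_sum] op_sum_apply[OF f]
            scaleC_scaleC scaleC_add_right mult.commute)
    qed
  qed
qed

lemma dim_eigenspace_op_sum:
  assumes "orthonormal_on {..<n} f" "\<sigma> > 0"
  shows "complex_vector.dim (eigenspace (op_sum n s f f) \<sigma>) = card {i. i < n \<and> s i = \<sigma>}"
proof -
  have on: "orthonormal_on {i. i < n \<and> s i = \<sigma>} f"
    using assms(1) by (rule orthonormal_on_subset) auto
  have "complex_vector.dim (eigenspace (op_sum n s f f) \<sigma>) = card (f ` {i. i < n \<and> s i = \<sigma>})"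
    unfolding eigenspace_op_sum[OF assms] complex_vector.dim_span
    by (rule complex_vector.dim_eq_card_independent[OF orthonormal_independent[OF on]])
  then show ?thesis
    by (simp add: card_image[OF orthonormal_on_inj[OF on]])
qed

section \<open>The sorted list of singular values\<close>

lemma count_concat_replicate:
  assumes "distinct xs"
  shows "count (mset (concat (map (\<lambda>x. replicate (c x) x) xs))) y = (if y \<in> set xs then c y else 0)"
  using assms by (induction xs) auto

lemma sorted_wrt_concat_replicate:
  assumes "sorted_wrt (\<ge>) (xs :: 'b::linorder list)"
  shows "sorted_wrt (\<ge>) (concat (map (\<lambda>x. replicate (c x) x) xs))"
proof -
  have "sorted_wrt (\<ge>) (replicate k x)" for k and x :: 'b
    by (induction k) auto
  then show ?thesis
    using assms by (induction xs) (auto simp: sorted_wrt_append)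
qed

lemma count_map_upt: "count (mset (map s [0..<n])) x = card {i. i < n \<and> s i = x}"
proof (induction n)
  case (Suc n)
  have "{i. i < Suc n \<and> s i = x}
      = (if s n = x then insert n {i. i < n \<and> s i = x} else {i. i < n \<and> s i = x})"
    by (auto simp: less_Suc_eq)
  then show ?case
    using Suc by simp
qed simp

text \<open>Both lists are decreasing and contain each value equally often, and a sorted list is
  determined by its multiset.\<close>

lemma positive_singular_values_svd:
  assumes "svd T n s e f"
  shows "positive_singular_values T = map s [0..<n]"
proof -
  have f: "orthonormal_on {..<n} f" and s: "\<And>i. i < n \<Longrightarrow> 0 < s i"
    and dec: "\<And>i j. i \<le> j \<Longrightarrow> j < n \<Longrightarrow> s j \<le> s i"
    using assms unfolding svd_def by blast+
  let ?xs = "rev (sorted_list_of_set (s ` {..<n}))"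
  have nontrivial: "eigenspace (abs_op T) \<sigma> \<noteq> {0} \<longleftrightarrow> \<sigma> \<in> s ` {..<n}" if "\<sigma> > 0" for \<sigma>
  proof -
    have "complex_vector.span (f ` {i. i < n \<and> s i = \<sigma>}) = {0} \<longleftrightarrow> \<sigma> \<notin> s ` {..<n}"
    proof
      assume span: "complex_vector.span (f ` {i. i < n \<and> s i = \<sigma>}) = {0}"
      have "f i = 0" if "i < n" "s i = \<sigma>" for i
        using complex_vector.span_base[of "f i" "f ` {i. i < n \<and> s i = \<sigma>}"] that unfolding span by blast
      then show "\<sigma> \<notin> s ` {..<n}"
        using orthonormal_on_norm[OF f] by fastforce
    next
      assume "\<sigma> \<notin> s ` {..<n}"
      then have "{i. i < n \<and> s i = \<sigma>} = {}"
        by blast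
      then show "complex_vector.span (f ` {i. i < n \<and> s i = \<sigma>}) = {0}"
        by (simp only: image_empty complex_vector.span_empty)
    qed
    then show ?thesis
      unfolding abs_op_svd[OF assms] eigenspace_op_sum[OF f that] by (simp only: not_not)
  qed
  have set: "{\<sigma>. \<sigma> > 0 \<and> eigenspace (abs_op T) \<sigma> \<noteq> {0}} = s ` {..<n}"
  proof -
    have "{\<sigma>. \<sigma> > 0 \<and> eigenspace (abs_op T) \<sigma> \<noteq> {0}} = {\<sigma>. \<sigma> > 0 \<and> \<sigma> \<in> s ` {..<n}}"
      using nontrivial by (intro Collect_cong conj_cong refl)
    also have "\<dots> = s ` {..<n}"
      using s by blast
    finally show ?thesis .
  qed
  have psv: "positive_singular_values T
      = concat (map (\<lambda>\<sigma>. replicate (card {i. i < n \<and> s i = \<sigma>}) \<sigma>) ?xs)"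
    unfolding positive_singular_values_def set
    using s by (intro arg_cong[of _ _ concat] map_cong refl)
      (auto simp: abs_op_svd[OF assms] dim_eigenspace_op_sum[OF f])
  have "mset (positive_singular_values T) = mset (map s [0..<n])"
  proof (rule multiset_eqI)
    fix \<sigma>
    note count_map_upt[of s n \<sigma>]
    moreover have "card {i. i < n \<and> s i = \<sigma>} = 0" if "\<sigma> \<notin> s ` {..<n}"
      using that by auto
    ultimately show "count (mset (positive_singular_values T)) \<sigma> = count (mset (map s [0..<n])) \<sigma>"
      unfolding psv by (subst count_concat_replicate) auto
  qed
  moreover have "sorted_wrt (\<ge>) ?xs"
    using sorted_sorted_list_of_set[of "s ` {..<n}"] by (simp add: sorted_wrt_rev)
  then have "sorted_wrt (\<ge>) (positive_singular_values T)"
    unfolding psv by (rule sorted_wrt_concat_replicate)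
  then have "sorted (rev (positive_singular_values T))"
    by (simp add: sorted_wrt_rev)
  moreover have "sorted (rev (map s [0..<n]))"
    unfolding sorted_wrt_rev using dec by (auto simp: sorted_wrt_iff_nth_less)
  \<comment> \<open>Reversed, because \<open>properties_for_sort\<close> speaks of ascending
    lists.\<close>
  ultimately have "rev (positive_singular_values T) = rev (map s [0..<n])"
    by (metis mset_rev properties_for_sort)
  then show ?thesis
    by simp
qed

lemma singular_value_svd:
  "svd T n s e f \<Longrightarrow> singular_value T (Suc i) = (if i < n then s i else 0)"
  by (simp add: singular_value_def positive_singular_values_svd)

lemma suminf_singular_value:
  assumes "svd T n s e f"
  shows "(\<Sum>i. singular_value T (Suc i)) = (\<Sum>i<n. s i)"
  using suminf_finite[of "{..<n}" "\<lambda>i. singular_value T (Suc i)"]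
  by (simp add: singular_value_svd[OF assms])

lemma ky_fan_norm_enat: "ky_fan_norm (enat m) T = (\<Sum>i<m. singular_value T (Suc i))"
  unfolding ky_fan_norm_def
  by (simp add: sum.atLeast1_atMost_eq)

lemma trace_norm_svd:
  fixes T :: "'a::complex_inner \<Rightarrow> 'a"
  assumes "separable_space (euclidean :: 'a topology)" "svd T n s e f"
  shows "trace_norm T = (\<Sum>i<n. s i)"
proof -
  have f: "orthonormal_on {..<n} f"
    using assms(2) unfolding svd_def by blast
  have "abs_op T = (\<lambda>x. \<Sum>i<n. cinner x (f i) *\<^sub>C (complex_of_real (s i) *\<^sub>C f i))"
    unfolding abs_op_svd[OF assms(2)] op_sum_def [abs_def] by (simp add: scaleC_scaleC mult.commute)
  then have "trace_op (abs_op T) = (\<Sum>i<n. cinner (complex_of_real (s i) *\<^sub>C f i) (f i))"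
    by (simp only: trace_op_finite_sum[OF assms(1)])
  also have "\<dots> = (\<Sum>i<n. complex_of_real (s i))"
    by (intro sum.cong refl) (simp add: cinner_scaleC_left orthonormal_onD[OF f])
  finally show ?thesis
    by (simp add: trace_norm_def)
qed

lemma trace_op_comp_svd:
  fixes T :: "'a::complex_inner \<Rightarrow> 'a"
  assumes "separable_space (euclidean :: 'a topology)" "bounded_op T" "svd X q t g h"
  shows "trace_op (T \<circ> X) = (\<Sum>j<q. complex_of_real (t j) * cinner (T (g j)) (h j))"
proof -
  have X: "X = op_sum q t g h"
    using assms(3) unfolding svd_def by blast
  have "T \<circ> X = (\<lambda>x. \<Sum>j<q. cinner x (h j) *\<^sub>C (complex_of_real (t j) *\<^sub>C T (g j)))"
    unfolding X op_sum_def o_def linear_sum[OF bounded_linear.linear[OF bounded_opD(1)[OF assms(2)]]]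
    by (simp add: bounded_opD(2)[OF assms(2)] scaleC_scaleC mult.commute)
  then show ?thesis
    by (simp only: trace_op_finite_sum[OF assms(1)] cinner_scaleC_left)
qed

text \<open>The rank one test operator produces \<open>s 0\<close>, so this direction turns it into
  a lower bound by \<open>onorm T\<close>.\<close>

lemma onorm_svd_le:
  assumes "svd T n s e f" "0 < n"
  shows "onorm T \<le> s 0"
proof (rule onorm_bound)
  have e: "orthonormal_on {..<n} e" and f: "orthonormal_on {..<n} f"
    and s: "\<And>i. i < n \<Longrightarrow> 0 < s i" and T: "T = op_sum n s e f"
    and dec: "\<And>i j. i \<le> j \<Longrightarrow> j < n \<Longrightarrow> s j \<le> s i"
    using assms(1) unfolding svd_def by blast+
  show "0 \<le> s 0"
    using s[OF assms(2)] by simp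
  fix x
  have "(norm (T x))\<^sup>2 = (\<Sum>i<n. (s i)\<^sup>2 * (cmod (cinner x (f i)))\<^sup>2)"
    unfolding T op_sum_def by (subst norm_orthonormal_sum[OF e]) (auto simp: norm_mult power_mult_distrib)
  also have "\<dots> \<le> (\<Sum>i<n. (s 0)\<^sup>2 * (cmod (cinner x (f i)))\<^sup>2)"
    using dec s by (intro sum_mono mult_right_mono power_mono) (auto intro: less_imp_le)
  also have "\<dots> \<le> (s 0)\<^sup>2 * (norm x)\<^sup>2"
    unfolding sum_distrib_left[symmetric] using bessel[OF f, of x] by (intro mult_left_mono) auto
  finally have "(norm (T x))\<^sup>2 \<le> (s 0 * norm x)\<^sup>2"
    by (simp add: power_mult_distrib)
  then show "norm (T x) \<le> s 0 * norm x"
    using s[OF assms(2)] by (auto intro: power2_le_imp_le)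
qed

section \<open>Duality of the Ky Fan norms\<close>

text \<open>Mass \<open>m M\<close> distributed over decreasing weights with at most \<open>M\<close> at each place is best put on
  the first \<open>m\<close> places.\<close>

lemma sum_antimono_weights_le:
  fixes \<tau> u :: "nat \<Rightarrow> real"
  assumes dec: "\<And>i j. i \<le> j \<Longrightarrow> \<tau> j \<le> \<tau> i" and nonneg: "\<And>i. 0 \<le> \<tau> i"
    and u: "\<And>j. j < q \<Longrightarrow> 0 \<le> u j" "\<And>j. j < q \<Longrightarrow> u j \<le> M" and total: "(\<Sum>j<q. u j) \<le> real m * M"
    and M: "0 \<le> M"
  shows "(\<Sum>j<q. \<tau> j * u j) \<le> M * (\<Sum>j<m. \<tau> j)"
proof (cases "q \<le> m")
  case True
  have "(\<Sum>j<q. \<tau> j * u j) \<le> (\<Sum>j<q. \<tau> j * M)"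
    using u nonneg by (intro sum_mono mult_left_mono) auto
  also have "\<dots> \<le> (\<Sum>j<m. \<tau> j * M)"
    using True nonneg M by (intro sum_mono2) auto
  finally show ?thesis
    by (simp add: sum_distrib_left mult.commute)
next
  case False
  have "\<tau> j * u j \<le> \<tau> m * u j + (if j < m then (\<tau> j - \<tau> m) * M else 0)" if "j < q" for j
  proof (cases "j < m")
    case True
    have "(\<tau> j - \<tau> m) * u j \<le> (\<tau> j - \<tau> m) * M"
      using dec[of j m] u(2)[OF that] True by (intro mult_left_mono) auto
    then show ?thesis
      using True by (simp add: algebra_simps)
  next
    case False
    then show ?thesis
      using dec[of m j] u(1)[OF that] by (simp add: mult_right_mono)
  qed
  then have "(\<Sum>j<q. \<tau> j * u j) \<le> (\<Sum>j<q. \<tau> m * u j + (if j < m then (\<tau> j - \<tau> m) * M else 0))"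
    by (intro sum_mono) auto
  also have "\<dots> = \<tau> m * (\<Sum>j<q. u j) + (\<Sum>j<m. (\<tau> j - \<tau> m) * M)"
  proof -
    have "{..<q} \<inter> {j. j < m} = {..<m}"
      using False by auto
    then show ?thesis
      by (simp add: sum.distrib sum_distrib_left sum.If_cases)
  qed
  also have "\<dots> \<le> \<tau> m * (real m * M) + (\<Sum>j<m. (\<tau> j - \<tau> m) * M)"
    using total nonneg by (intro add_right_mono mult_left_mono)
  also have "\<dots> = M * (\<Sum>j<m. \<tau> j)"
    by (simp add: algebra_simps sum_subtractf sum_distrib_left)
  finally show ?thesis .
qed

text \<open>After swapping the sums, s_i is multiplied by the sum over j of |<g_j, f_i>| |<e_i,
  h_j>|. Since a b <= (a^2 + b^2) / 2, this is at most the mean of two Bessel sums for unit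
  vectors.\<close>

lemma sum_cmod_cinner_le:
  fixes q :: nat
  assumes T: "svd T n s e f" and g: "orthonormal_on {..<q} g" and h: "orthonormal_on {..<q} h"
  shows "(\<Sum>j<q. cmod (cinner (T (g j)) (h j))) \<le> (\<Sum>i<n. s i)"
proof -
  have e: "orthonormal_on {..<n} e" and f: "orthonormal_on {..<n} f"
    and s: "\<And>i. i < n \<Longrightarrow> 0 < s i" and T: "T = op_sum n s e f"
    using assms(1) unfolding svd_def by blast+
  have sym: "cmod (cinner x y) = cmod (cinner y x)" for x y :: 'a
    using cinner_commute[of x y] by simp
  have one: "(\<Sum>j<q. cmod (cinner (g j) (f i)) * cmod (cinner (e i) (h j))) \<le> 1" if "i < n" for i
  proof -
    have "(\<Sum>j<q. cmod (cinner (g j) (f i)) * cmod (cinner (e i) (h j)))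
        \<le> (\<Sum>j<q. ((cmod (cinner (f i) (g j)))\<^sup>2 + (cmod (cinner (e i) (h j)))\<^sup>2) / 2)"
    proof (intro sum_mono)
      fix j
      show "cmod (cinner (g j) (f i)) * cmod (cinner (e i) (h j))
          \<le> ((cmod (cinner (f i) (g j)))\<^sup>2 + (cmod (cinner (e i) (h j)))\<^sup>2) / 2"
        using sum_squares_bound[of "cmod (cinner (g j) (f i))" "cmod (cinner (e i) (h j))"]
          sym[of "f i" "g j"] by simp
    qed
    also have "\<dots> = ((\<Sum>j<q. (cmod (cinner (f i) (g j)))\<^sup>2) + (\<Sum>j<q. (cmod (cinner (e i) (h j)))\<^sup>2)) / 2"
      by (simp add: sum.distrib flip: sum_divide_distrib)
    also have "\<dots> \<le> 1"
      using bessel[OF g, of "f i"] bessel[OF h, of "e i"] that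
        orthonormal_on_norm[OF e, of i] orthonormal_on_norm[OF f, of i] by simp
    finally show ?thesis .
  qed
  have "(\<Sum>j<q. cmod (cinner (T (g j)) (h j)))
      \<le> (\<Sum>j<q. \<Sum>i<n. s i * (cmod (cinner (g j) (f i)) * cmod (cinner (e i) (h j))))"
  proof (intro sum_mono)
    fix j
    have "cmod (cinner (T (g j)) (h j))
        \<le> (\<Sum>i<n. cmod (complex_of_real (s i) * cinner (g j) (f i) * cinner (e i) (h j)))"
      unfolding T op_sum_def cinner_sum_left cinner_scaleC_left by (rule norm_sum)
    also have "\<dots> = (\<Sum>i<n. s i * (cmod (cinner (g j) (f i)) * cmod (cinner (e i) (h j))))"
      using s by (intro sum.cong refl) (simp add: norm_mult mult.assoc abs_of_pos)
    finally show "cmod (cinner (T (g j)) (h j))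
        \<le> (\<Sum>i<n. s i * (cmod (cinner (g j) (f i)) * cmod (cinner (e i) (h j))))" .
  qed
  also have "\<dots> = (\<Sum>i<n. s i * (\<Sum>j<q. cmod (cinner (g j) (f i)) * cmod (cinner (e i) (h j))))"
    unfolding sum_distrib_left by (rule sum.swap)
  also have "\<dots> \<le> (\<Sum>i<n. s i * 1)"
    using one s by (intro sum_mono mult_left_mono) (auto intro: less_imp_le)
  finally show ?thesis
    by simp
qed

lemma finite_rank_svd:
  assumes "svd T n s e f"
  shows "T \<in> finite_rank_ops"
proof -
  have T: "T = op_sum n s e f"
    using assms unfolding svd_def by blast
  have "T x \<in> complex_vector.span (e ` {..<n})" for x
    unfolding T op_sum_def
    by (intro complex_vector.span_sum complex_vector.span_scale complex_vector.span_base) auto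
  then show ?thesis
    using bounded_op_op_sum[of n s e f] unfolding finite_rank_ops_def T by blast
qed

section \<open>Upper bound for the dual norm\<close>

lemma cmod_trace_op_le:
  fixes T X :: "'a::complex_hilbert \<Rightarrow> 'a"
  assumes sep: "separable_space (euclidean :: 'a topology)"
    and T: "svd T n s e f" and X: "X \<in> finite_rank_ops" and k: "1 \<le> k"
    and M: "onorm T \<le> M" "\<And>m. k = enat m \<Longrightarrow> (\<Sum>i<n. s i) \<le> real m * M"
  shows "cmod (trace_op (T \<circ> X)) \<le> M * ky_fan_norm k X"
proof -
  obtain q t g h where svd: "svd X q t g h"
    using svd_exists[OF X] by blast
  then have g: "orthonormal_on {..<q} g" and h: "orthonormal_on {..<q} h"
    and t: "\<And>j. j < q \<Longrightarrow> 0 < t j" and dec: "\<And>i j. i \<le> j \<Longrightarrow> j < q \<Longrightarrow> t j \<le> t i"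
    unfolding svd_def by blast+
  have bT: "bounded_op T"
    using finite_rank_svd[OF T] unfolding finite_rank_ops_def by blast
  define \<tau> where "\<tau> j = singular_value X (Suc j)" for j
  define u where "u j = cmod (cinner (T (g j)) (h j))" for j
  \<comment> \<open>Padding with zeros keeps the sequence decreasing on all indices, so
    \<open>m\<close> may exceed the rank \<open>q\<close>.\<close>
  have \<tau>: "\<tau> j = (if j < q then t j else 0)" for j
    unfolding \<tau>_def by (rule singular_value_svd[OF svd])
  have "0 \<le> M"
    using M(1) onorm_pos_le[OF bounded_opD(1)[OF bT]] by linarith
  have u: "u j \<le> M" if "j < q" for j
  proof -
    have "u j \<le> norm (T (g j)) * norm (h j)"
      unfolding u_def by (rule cmod_cinner_le)
    also have "\<dots> \<le> onorm T"
      using onorm[OF bounded_opD(1)[OF bT], of "g j"] that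
        orthonormal_on_norm[OF g, of j] orthonormal_on_norm[OF h, of j] by simp
    finally show ?thesis
      using M(1) by linarith
  qed
  have "cmod (trace_op (T \<circ> X)) \<le> (\<Sum>j<q. cmod (complex_of_real (t j) * cinner (T (g j)) (h j)))"
    unfolding trace_op_comp_svd[OF sep bT svd] by (rule norm_sum)
  also have "\<dots> = (\<Sum>j<q. \<tau> j * u j)"
    using t by (intro sum.cong refl) (simp add: norm_mult u_def \<tau> abs_of_pos)
  also have "\<dots> \<le> M * ky_fan_norm k X"
  proof (cases k)
    case (enat m)
    have "(\<Sum>j<q. u j) \<le> real m * M"
      using sum_cmod_cinner_le[OF T g h] M(2)[OF enat] unfolding u_def by linarith
    moreover have "0 \<le> \<tau> i" for i
      using t[of i] by (simp add: \<tau> less_imp_le)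
    moreover have "\<tau> j \<le> \<tau> i" if "i \<le> j" for i j
      using dec[OF that] t[of i] that by (simp add: \<tau> less_imp_le)
    moreover have "0 \<le> u j" for j
      by (simp add: u_def)
    ultimately have "(\<Sum>j<q. \<tau> j * u j) \<le> M * (\<Sum>j<m. \<tau> j)"
      using u \<open>0 \<le> M\<close> by (intro sum_antimono_weights_le)
    then show ?thesis
      by (simp add: enat ky_fan_norm_enat \<tau>_def)
  next
    case infinity
    have "(\<Sum>j<q. \<tau> j * u j) \<le> (\<Sum>j<q. \<tau> j * M)"
      using u t by (intro sum_mono mult_left_mono) (auto simp: \<tau> less_imp_le)
    also have "\<dots> = M * (\<Sum>j<q. t j)"
      unfolding sum_distrib_left by (intro sum.cong refl) (simp add: \<tau>)
    also have "(\<Sum>j<q. t j) = ky_fan_norm k X"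
      by (simp add: ky_fan_norm_def infinity suminf_singular_value[OF svd])
    finally show ?thesis .
  qed
  finally show ?thesis .
qed

section \<open>Lower bound for the dual norm\<close>

text \<open>The sum of the first l singular values is min(l, m) c. Bounding the minimum by m suits a
  test operator of rank one, bounding it by l suits the weight 1/k at arbitrary rank.\<close>

lemma ky_fan_norm_flat:
  assumes "svd X m (\<lambda>_. c) g h" "0 \<le> c"
  shows "ky_fan_norm k X \<le> real m * c" "ky_fan_norm (enat l) X \<le> real l * c"
proof -
  have sum: "(\<Sum>i<l. singular_value X (Suc i)) = real (min l m) * c" for l
  proof -
    have "(\<Sum>i<l. singular_value X (Suc i)) = (\<Sum>i\<in>{..<l} \<inter> {..<m}. c)"
      unfolding singular_value_svd[OF assms(1)] by (subst sum.inter_restrict) auto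
    also have "{..<l} \<inter> {..<m} = {..<min l m}"
      by auto
    finally show ?thesis
      by simp
  qed
  show "ky_fan_norm k X \<le> real m * c"
  proof (cases k)
    case (enat l)
    then show ?thesis
      using assms(2) by (simp add: ky_fan_norm_enat sum mult_right_mono)
  next
    case infinity
    then show ?thesis
      by (simp add: ky_fan_norm_def suminf_singular_value[OF assms(1)])
  qed
  show "ky_fan_norm (enat l) X \<le> real l * c"
    using assms(2) by (simp add: ky_fan_norm_enat sum mult_right_mono)
qed

text \<open>Tests the dual norm against a multiple of the partial isometry that sends the left singular
  vectors of \<open>T\<close> back to the right ones.\<close>

lemma dual_norm_ge:
  fixes T :: "'a::complex_inner \<Rightarrow> 'a"
  assumes sep: "separable_space (euclidean :: 'a topology)"
    and T: "svd T n s e f" and m: "m \<le> n" and c: "0 < c"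
    and "real m * c \<le> 1 \<or> (\<exists>l. k = enat l \<and> real l * c \<le> 1)"
  shows "ereal (c * (\<Sum>i<m. s i)) \<le> dual_norm (ky_fan_norm k) T"
proof -
  have e: "orthonormal_on {..<n} e" and f: "orthonormal_on {..<n} f"
    and s: "\<And>i. i < n \<Longrightarrow> 0 < s i" and T': "T = op_sum n s e f"
    using T unfolding svd_def by blast+
  define X where "X = op_sum m (\<lambda>_. c) f e"
  have X: "svd X m (\<lambda>_. c) f e"
    unfolding svd_def X_def using m c
    by (auto intro: orthonormal_on_subset[OF e] orthonormal_on_subset[OF f])
  have "bounded_op T"
    unfolding T' by (rule bounded_op_op_sum)
  then have "trace_op (T \<circ> X) = (\<Sum>j<m. complex_of_real c * cinner (T (f j)) (e j))"
    by (rule trace_op_comp_svd[OF sep _ X])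
  also have "\<dots> = complex_of_real (c * (\<Sum>i<m. s i))"
    unfolding T' of_real_mult of_real_sum sum_distrib_left using m
    by (intro sum.cong refl)
      (simp add: op_sum_apply[OF f] cinner_scaleC_left orthonormal_onD[OF e])
  moreover have "0 \<le> c * (\<Sum>i<m. s i)"
    using c s m by (intro mult_nonneg_nonneg sum_nonneg) (auto simp: less_imp_le)
  ultimately have "cmod (trace_op (T \<circ> X)) = c * (\<Sum>i<m. s i)"
    by (simp only: norm_of_real abs_of_nonneg)
  \<comment> \<open>The first alternative of the last assumption admits the rank one test for every
    \<open>k\<close>; the second admits the test with c = 1/k for finite \<open>k\<close>.\<close>
  moreover have "ky_fan_norm k X \<le> 1"
    using ky_fan_norm_flat[OF X] c assms(5) by (meson less_imp_le order_trans)
  ultimately show ?thesis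
    unfolding dual_norm_def using finite_rank_svd[OF X] by (intro SUP_upper2[of X]) auto
qed

theorem theorem5p11:
  fixes T :: "'h::complex_hilbert \<Rightarrow> 'h" and k :: enat
  assumes separable: "separable_space (euclidean :: 'h topology)"
    and infinite_dimensional: "\<not> (\<exists>B::'h set. finite B \<and> complex_vector.span B = UNIV)"
    and T: "T \<in> finite_rank_ops"
    and k: "1 \<le> k"
  shows "dual_norm (ky_fan_norm k) T
           = max (ereal (onorm T)) (1 / ereal_of_enat k * ereal (trace_norm T))
         \<and> trace_norm T = (\<Sum>i. singular_value T (Suc i))"
proof
  obtain n s e f where svd: "svd T n s e f"
    using svd_exists[OF T] by blast
  have tn: "trace_norm T = (\<Sum>i<n. s i)"
    by (rule trace_norm_svd[OF separable svd])
  then show "trace_norm T = (\<Sum>i. singular_value T (Suc i))"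
    by (simp add: suminf_singular_value[OF svd])
  have bT: "bounded_linear T"
    using T by (simp add: finite_rank_ops_def bounded_opD(1))
  \<comment> \<open>A real version of 1/k with the value 0 at infinity, so that the estimates can be
    made in the reals.\<close>
  define c where "c = (case k of enat m \<Rightarrow> 1 / real m | \<infinity> \<Rightarrow> 0)"
  define M where "M = max (onorm T) (c * trace_norm T)"
  have c: "1 / ereal_of_enat k = ereal c"
    using k by (cases k) (auto simp: c_def one_ereal_def one_enat_def)
  have "dual_norm (ky_fan_norm k) T \<le> ereal M"
    unfolding dual_norm_def
  proof (rule SUP_least)
    fix X :: "'h \<Rightarrow> 'h" assume X: "X \<in> {X \<in> finite_rank_ops. ky_fan_norm k X \<le> 1}"
    have "(\<Sum>i<n. s i) \<le> real m * M" if "k = enat m" for m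
    proof -
      have "m > 0"
        using k that by (simp add: one_enat_def)
      have "c * trace_norm T \<le> M"
        by (simp add: M_def)
      then show ?thesis
        using \<open>m > 0\<close> by (simp add: c_def that tn field_simps)
    qed
    then have "cmod (trace_op (T \<circ> X)) \<le> M * ky_fan_norm k X"
      using X k by (intro cmod_trace_op_le[OF separable svd]) (auto simp: M_def)
    also have "\<dots> \<le> M * 1"
      using X onorm_pos_le[OF bT] by (intro mult_left_mono) (auto simp: M_def)
    finally show "ereal (cmod (trace_op (T \<circ> X))) \<le> ereal M"
      by simp
  qed
  moreover have onorm: "ereal (onorm T) \<le> dual_norm (ky_fan_norm k) T"
  proof -
    \<comment> \<open>Taking \<open>min 1 n\<close> covers T = 0, where no singular vector is
      available and the sum is empty.\<close>
    have "onorm T \<le> 1 * (\<Sum>i<min 1 n. s i)"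
    proof (cases "n = 0")
      case True
      then have "T = (\<lambda>_. 0)"
        using svd by (auto simp: svd_def op_sum_def)
      then show ?thesis
        using True by (simp add: onorm_zero)
    next
      case False
      then have "min 1 n = Suc 0"
        by simp
      then show ?thesis
        using onorm_svd_le[OF svd] False by simp
    qed
    also have "ereal (1 * (\<Sum>i<min 1 n. s i)) \<le> dual_norm (ky_fan_norm k) T"
      by (rule dual_norm_ge[OF separable svd]) auto
    finally show ?thesis
      by simp
  qed
  moreover have "ereal (c * trace_norm T) \<le> dual_norm (ky_fan_norm k) T"
  proof (cases k)
    case (enat m)
    then have "m > 0"
      using k by (simp add: one_enat_def)
    \<comment> \<open>The test operator uses all \<open>n\<close> pairs of singular vectors with
      weight 1/m; its Ky Fan norm is at most 1 even if \<open>n\<close> exceeds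
      \<open>m\<close>.\<close>
    then show ?thesis
      unfolding tn using enat by (intro dual_norm_ge[OF separable svd]) (auto simp: c_def)
  next
    case infinity
    \<comment> \<open>With c = 0 the trace term is 0, hence already dominated by the operator
      norm.\<close>
    then have "ereal (c * trace_norm T) \<le> ereal (onorm T)"
      using onorm_pos_le[OF bT] by (simp add: c_def)
    then show ?thesis
      using onorm by (rule order_trans)
  qed
  ultimately have "dual_norm (ky_fan_norm k) T = ereal M"
    by (intro antisym) (auto simp: M_def max_def)
  then show "dual_norm (ky_fan_norm k) T
      = max (ereal (onorm T)) (1 / ereal_of_enat k * ereal (trace_norm T))"
    unfolding c M_def by (simp add: max_def)
qed

end
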